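(* Let $q\ge2$ be an integer, $n=q+2$, $a>1$, and let $m$ be a positive integer. (1) Let $\mathcal{X}$ be a polynomial vector field of degree $m$ on $S_{1,q}$ such that there are only finitely many invariant algebraic sets of $\mathcal{X}$. Then $\mathcal{X}$ has at most $2(m-1)$ invariant meridians. (2) If $m-1\ge q$, there exists a polynomial vector field of degree $m$ on $S_{1,q}$ with exactly $2(m-1)$ invariant meridians. Here each of the two connected components of $\{a_1x_1+a_2x_2=0\}\cap S_{1,q}$ is counted as one invariant meridian when the hyperplane $\{a_1x_1+a_2x_2=0\}$ is invariant.
   Context: $S_{1,q}\subset\mathbb{R}^{n}$ is the hypersurface $\{h=0\}$, where $h=(x_1^2+x_2^2-a^2)^2+\sum_{j=3}^{n}x_j^2-1$. A polynomial vector field $\mathcal{X}=(R_1,\ldots,R_n)=\sum_iR_i\,\partial/\partial x_i$ has degree $\max_i\deg R_i$ and is a vector field on $S_{1,q}$ if $\mathcal{X}h=Kh$ for some $K\in\mathbb{R}[x_1,\ldots,x_n]$. An invariant algebraic set of $\mathcal{X}$ is the zero set of a polynomial $f$ with $\mathcal{X}f=Kf$ for some polynomial $K$. Meridians on $S_{1,q}$ come from intersections of $S_{1,q}$ with hyperplanes $\{a_1x_1+a_2x_2=0\}$, $a_1,a_2\in\mathbb{R}$ not both zero; such a hyperplane (and the meridian) is invariant for $\mathcal{X}$ if $\mathcal{X}(a_1x_1+a_2x_2)=K(a_1x_1+a_2x_2)$ for some $K\in\mathbb{R}[x_1,\ldots,x_n]$. Counting convention: only hypersurfaces of finite multiplicity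 are considered, and they are counted with multiplicity, where the multiplicity of $\{g=0\}$, $g=a_1x_1+a_2x_2$, is the largest $\mu$ with $g^\mu\mid x_1R_2-x_2R_1$ (defined only if $x_1R_2-x_2R_1\neq0$). *)

theory Defs
  imports "HOL-Analysis.Analysis" "HOL-Library.Poly_Mapping"
begin

section \<open>Real polynomials in variables indexed by a finite type\<close>

text \<open>A polynomial maps exponent vectors to coefficients; the multiplication of
  \<^typ>\<open>('n \<Rightarrow>\<^sub>0 nat) \<Rightarrow>\<^sub>0 real\<close> is the convolution product, i.e. the one of the polynomial ring.\<close>

type_synonym 'n mpoly = "('n \<Rightarrow>\<^sub>0 nat) \<Rightarrow>\<^sub>0 real"

definition Const :: "real \<Rightarrow> 'n mpoly" where
  "Const c = Poly_Mapping.single 0 c"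

definition Var :: "'n \<Rightarrow> 'n mpoly" where
  "Var i = Poly_Mapping.single (Poly_Mapping.single i 1) 1"

text \<open>The total degree, with the convention that the zero polynomial has degree 0.\<close>

definition total_degree :: "'n::finite mpoly \<Rightarrow> nat" where
  "total_degree p = Max (insert 0 ((\<lambda>e. \<Sum>i\<in>UNIV. Poly_Mapping.lookup e i) ` Poly_Mapping.keys p))"

definition mpoly_eval :: "'n::finite mpoly \<Rightarrow> real ^ 'n \<Rightarrow> real" where
  "mpoly_eval p x =
     (\<Sum>e\<in>Poly_Mapping.keys p. Poly_Mapping.lookup p e * (\<Prod>i\<in>UNIV. (x $ i) ^ Poly_Mapping.lookup e i))"

text \<open>The subtraction of exponents is truncated, but only where the new coefficient is 0.\<close>

definition partial_deriv :: "'n \<Rightarrow> 'n mpoly \<Rightarrow> 'n mpoly" where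
  "partial_deriv i p =
     (\<Sum>e\<in>Poly_Mapping.keys p.
        Poly_Mapping.single (e - Poly_Mapping.single i 1)
          (Poly_Mapping.lookup p e * real (Poly_Mapping.lookup e i)))"

definition zero_set :: "'n::finite mpoly \<Rightarrow> (real ^ 'n) set" where
  "zero_set p = {x. mpoly_eval p x = 0}"

section \<open>Polynomial vector fields\<close>

text \<open>A vector field is given by its components \<open>R i\<close>, one for each coordinate \<open>i\<close>.\<close>

definition vf_apply :: "('n::finite \<Rightarrow> 'n mpoly) \<Rightarrow> 'n mpoly \<Rightarrow> 'n mpoly" where
  "vf_apply R f = (\<Sum>i\<in>UNIV. R i * partial_deriv i f)"

definition vf_degree :: "('n::finite \<Rightarrow> 'n mpoly) \<Rightarrow> nat" where
  "vf_degree R = Max (range (\<lambda>i. total_degree (R i)))"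

definition vf_invariant :: "('n::finite \<Rightarrow> 'n mpoly) \<Rightarrow> 'n mpoly \<Rightarrow> bool" where
  "vf_invariant R f \<longleftrightarrow> (\<exists>K. vf_apply R f = K * f)"

definition invariant_algebraic_sets :: "('n::finite \<Rightarrow> 'n mpoly) \<Rightarrow> (real ^ 'n) set set" where
  "invariant_algebraic_sets R = {zero_set f | f. vf_invariant R f}"

section \<open>The hypersurface and its meridians\<close>

text \<open>Throughout, \<open>i1\<close> and \<open>i2\<close> are two distinct indices, namely those of the first two
  coordinates.\<close>

definition h_poly :: "'n::finite \<Rightarrow> 'n \<Rightarrow> real \<Rightarrow> 'n mpoly" where
  "h_poly i1 i2 a =
     ((Var i1)\<^sup>2 + (Var i2)\<^sup>2 - Const (a\<^sup>2))\<^sup>2 + (\<Sum>j\<in>UNIV - {i1, i2}. (Var j)\<^sup>2) - 1"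

definition S_surface :: "'n::finite \<Rightarrow> 'n \<Rightarrow> real \<Rightarrow> (real ^ 'n) set" where
  "S_surface i1 i2 a = zero_set (h_poly i1 i2 a)"

definition vf_on_S :: "'n::finite \<Rightarrow> 'n \<Rightarrow> real \<Rightarrow> ('n \<Rightarrow> 'n mpoly) \<Rightarrow> bool" where
  "vf_on_S i1 i2 a R \<longleftrightarrow> (\<exists>K. vf_apply R (h_poly i1 i2 a) = K * h_poly i1 i2 a)"

definition meridian_forms :: "'n \<Rightarrow> 'n \<Rightarrow> 'n mpoly set" where
  "meridian_forms i1 i2 =
     {Const a1 * Var i1 + Const a2 * Var i2 | a1 a2. (a1, a2) \<noteq> (0, 0)}"

definition invariant_meridians ::
    "'n::finite \<Rightarrow> 'n \<Rightarrow> real \<Rightarrow> ('n \<Rightarrow> 'n mpoly) \<Rightarrow> (real ^ 'n) set set" where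
  "invariant_meridians i1 i2 a R =
     {M. \<exists>g\<in>meridian_forms i1 i2. vf_invariant R g \<and>
           M \<in> components (zero_set g \<inter> S_surface i1 i2 a)}"

definition extactic :: "'n \<Rightarrow> 'n \<Rightarrow> ('n \<Rightarrow> 'n mpoly) \<Rightarrow> 'n mpoly" where
  "extactic i1 i2 R = Var i1 * R i2 - Var i2 * R i1"

text \<open>Meaningful only if the polynomial \<open>extactic i1 i2 R\<close> is nonzero.\<close>

definition hyperplane_mult :: "'n \<Rightarrow> 'n \<Rightarrow> ('n \<Rightarrow> 'n mpoly) \<Rightarrow> 'n mpoly \<Rightarrow> nat" where
  "hyperplane_mult i1 i2 R g = (GREATEST k. g ^ k dvd extactic i1 i2 R)"

text \<open>The multiplicity of a meridian is that of the hyperplane containing it. For \<open>a > 1\<close>, the form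
  chosen below is determined by the meridian up to a nonzero constant factor, because distinct
  hyperplanes meet only where the first two coordinates vanish, hence outside the hypersurface.\<close>

definition meridian_mult ::
    "'n::finite \<Rightarrow> 'n \<Rightarrow> real \<Rightarrow> ('n \<Rightarrow> 'n mpoly) \<Rightarrow> (real ^ 'n) set \<Rightarrow> nat" where
  "meridian_mult i1 i2 a R M =
     hyperplane_mult i1 i2 R
       (SOME g. g \<in> meridian_forms i1 i2 \<and> M \<in> components (zero_set g \<inter> S_surface i1 i2 a))"

text \<open>The vector field has exactly \<open>N\<close> invariant meridians, counted with multiplicity. The count
  exists only if the multiplicities are finite.\<close>

definition has_meridian_count ::
    "'n::finite \<Rightarrow> 'n \<Rightarrow> real \<Rightarrow> ('n \<Rightarrow> 'n mpoly) \<Rightarrow> nat \<Rightarrow> bool" where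
  "has_meridian_count i1 i2 a R N \<longleftrightarrow>
     extactic i1 i2 R \<noteq> 0 \<and>
     finite (invariant_meridians i1 i2 a R) \<and>
     (\<Sum>M\<in>invariant_meridians i1 i2 a R. meridian_mult i1 i2 a R M) = N"

end

theory Submission
  imports Defs "HOL-Computational_Algebra.Polynomial_Factorial" "HOL-Computational_Algebra.Field_as_Ring"
begin

text \<open>Write \<open>E = x\<^sub>1R\<^sub>2 - x\<^sub>2R\<^sub>1\<close> for the extactic polynomial and \<open>A = x\<^sub>1R\<^sub>1 + x\<^sub>2R\<^sub>2\<close>. A linear form in
  \<open>x\<^sub>1, x\<^sub>2\<close> that defines an invariant hyperplane divides \<open>E\<close>, and \<open>E\<close> has degree at most \<open>m + 1\<close>. This alone
  bounds the multiplicities of the invariant hyperplanes by \<open>m + 1\<close> in total; the sharp bound \<open>m - 1\<close> uses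
  tangency. Tangency reads
  \<open>4 (x\<^sub>1\<^sup>2 + x\<^sub>2\<^sup>2 - a\<^sup>2) A + 2 (\<Sum>j\<ge>3. x\<^sub>jR\<^sub>j) = K h\<close>, and comparing the two highest degrees shows that
  \<open>r\<^sup>2 = x\<^sub>1\<^sup>2 + x\<^sub>2\<^sup>2\<close> divides the parts of \<open>A\<close> of degree \<open>m + 1\<close> and \<open>m\<close>. Because of
  \<open>x\<^sub>1E + x\<^sub>2A = r\<^sup>2R\<^sub>2\<close> and \<open>x\<^sub>1A - x\<^sub>2E = r\<^sup>2R\<^sub>1\<close>, it also divides these parts of \<open>E\<close>. Since \<open>r\<^sup>2\<close> has no real linear
  factor, a nonzero part of \<open>E\<close> of degree \<open>m\<close> or \<open>m + 1\<close> leaves room for at most \<open>m - 1\<close> linear factors; a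
  part of smaller degree has at most \<open>m - 1\<close> linear factors anyway. This is
  \<open>sum_pencil_multiplicities_le\<close>. It is carried out in \<open>\<real>[s][t]\<close>, with the coordinates from the third on
  fixed at the values of a point where \<open>E\<close> does not vanish and with \<open>x\<^sub>1\<close>, \<open>x\<^sub>2\<close> replaced by \<open>t\<close> times linear
  polynomials in \<open>s\<close>. Degree is then the degree in \<open>t\<close>, \<open>r\<^sup>2\<close> becomes a constant times \<open>(1 + s\<^sup>2) t\<^sup>2\<close>, and the
  factorisation takes place in the principal ideal domain \<open>\<real>[s]\<close>.

  Every hyperplane of the pencil cuts the hypersurface in exactly two components
  (\<open>card_components_meridian\<close>), so the count of meridians is twice the count of hyperplanes
  (\<open>sum_hyperplane_mults\<close>). If there are only finitely many invariant algebraic sets, then \<open>E \<noteq> 0\<close>: otherwise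
  \<open>R\<^sub>1 = x\<^sub>1P\<close> and \<open>R\<^sub>2 = x\<^sub>2P\<close> for some \<open>P\<close>, and all hyperplanes of the pencil are invariant.

  The bound is attained by the rotation \<open>(- x\<^sub>2, x\<^sub>1, 0, \<dots>, 0)\<close> multiplied by the power of \<open>x\<^sub>1\<close> with
  exponent \<open>m - 1\<close>. It annihilates \<open>h\<close>, and both meridians in \<open>x\<^sub>1 = 0\<close> have multiplicity at least \<open>m - 1\<close>;
  by the upper bound the multiplicity is \<open>m - 1\<close> and there are no others.\<close>

section \<open>Substitution into polynomials\<close>

lemma mpoly_induct [case_names single add]:
  fixes p :: "'n mpoly"
  assumes single: "\<And>e c. P (Poly_Mapping.single e c)"
    and add: "\<And>p q. P p \<Longrightarrow> P q \<Longrightarrow> P (p + q)"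
  shows "P p"
proof (induction p rule: update_induct)
  case const
  show ?case using single[of 0 0] by simp
next
  case (update f e c)
  have "Poly_Mapping.update e c f = f + Poly_Mapping.single e c"
    using update(1)
    by (intro poly_mapping_eqI) (auto simp: lookup_update lookup_add lookup_single in_keys_iff when_def)
  then show ?case using add[OF update(3) single] by simp
qed

text \<open>General enough for both targets that occur: the reals, for evaluation at a point, and
  \<^typ>\<open>real poly poly\<close>, the polynomials in an inner variable \<open>s\<close> and an outer variable \<open>t\<close>.\<close>

definition mpoly_subst :: "(real \<Rightarrow> 'r::comm_ring_1) \<Rightarrow> ('n::finite \<Rightarrow> 'r) \<Rightarrow> 'n mpoly \<Rightarrow> 'r" where
  "mpoly_subst \<phi> \<sigma> p =
     (\<Sum>e\<in>Poly_Mapping.keys p. \<phi> (Poly_Mapping.lookup p e) * (\<Prod>i\<in>UNIV. \<sigma> i ^ Poly_Mapping.lookup e i))"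

locale real_hom =
  fixes \<phi> :: "real \<Rightarrow> 'r::comm_ring_1"
  assumes hom_0: "\<phi> 0 = 0" and hom_1: "\<phi> 1 = 1"
    and hom_add: "\<And>x y. \<phi> (x + y) = \<phi> x + \<phi> y"
    and hom_mult: "\<And>x y. \<phi> (x * y) = \<phi> x * \<phi> y"
begin

lemma hom_sum: "\<phi> (\<Sum>j\<in>A. f j) = (\<Sum>j\<in>A. \<phi> (f j))"
  by (induction A rule: infinite_finite_induct) (simp_all add: hom_0 hom_add)

lemma subst_superset:
  assumes "finite A" "Poly_Mapping.keys p \<subseteq> A"
  shows "mpoly_subst \<phi> \<sigma> p =
    (\<Sum>e\<in>A. \<phi> (Poly_Mapping.lookup p e) * (\<Prod>i\<in>UNIV. \<sigma> i ^ Poly_Mapping.lookup e i))"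
  unfolding mpoly_subst_def using assms
  by (intro sum.mono_neutral_left) (auto simp: in_keys_iff hom_0)

lemma subst_single:
  "mpoly_subst \<phi> \<sigma> (Poly_Mapping.single e c) = \<phi> c * (\<Prod>i\<in>UNIV. \<sigma> i ^ Poly_Mapping.lookup e i)"
  by (subst subst_superset[of "{e}"]) auto

lemma subst_0: "mpoly_subst \<phi> \<sigma> 0 = 0"
  by (simp add: mpoly_subst_def)

lemma subst_add: "mpoly_subst \<phi> \<sigma> (p + q) = mpoly_subst \<phi> \<sigma> p + mpoly_subst \<phi> \<sigma> q"
proof -
  let ?A = "Poly_Mapping.keys p \<union> Poly_Mapping.keys q"
  have "Poly_Mapping.keys (p + q) \<subseteq> ?A" by (rule keys_add)
  then show ?thesis
    by (simp add: subst_superset[of ?A] lookup_add hom_add ring_distribs sum.distrib)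
qed

lemma subst_single_mult:
  "mpoly_subst \<phi> \<sigma> (Poly_Mapping.single e c * q)
     = mpoly_subst \<phi> \<sigma> (Poly_Mapping.single e c) * mpoly_subst \<phi> \<sigma> q"
proof (induction q rule: mpoly_induct)
  case (single f d)
  show ?case
    by (simp add: mult_single subst_single lookup_add hom_mult power_add prod.distrib ac_simps)
qed (simp add: subst_add ring_distribs)

lemma subst_mult: "mpoly_subst \<phi> \<sigma> (p * q) = mpoly_subst \<phi> \<sigma> p * mpoly_subst \<phi> \<sigma> q"
proof (induction p rule: mpoly_induct)
  case (single e c)
  show ?case by (rule subst_single_mult)
qed (simp add: subst_add ring_distribs)

lemma subst_1: "mpoly_subst \<phi> \<sigma> 1 = 1"
  using subst_single[of \<sigma> 0 1] by (simp add: hom_1)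

lemma subst_uminus: "mpoly_subst \<phi> \<sigma> (- p) = - mpoly_subst \<phi> \<sigma> p"
proof -
  have "mpoly_subst \<phi> \<sigma> p + mpoly_subst \<phi> \<sigma> (- p) = 0"
    using subst_add[of \<sigma> p "- p"] by (simp add: subst_0)
  then show ?thesis by (simp add: add_eq_0_iff)
qed

lemma subst_diff: "mpoly_subst \<phi> \<sigma> (p - q) = mpoly_subst \<phi> \<sigma> p - mpoly_subst \<phi> \<sigma> q"
  using subst_add[of \<sigma> p "- q"] by (simp add: subst_uminus)

lemma subst_numeral: "mpoly_subst \<phi> \<sigma> (numeral k) = numeral k"
  by (induction k) (simp_all only: numeral.simps subst_1 subst_add)

lemma subst_power: "mpoly_subst \<phi> \<sigma> (p ^ k) = mpoly_subst \<phi> \<sigma> p ^ k"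
  by (induction k) (simp_all add: subst_1 subst_mult)

lemma subst_sum: "mpoly_subst \<phi> \<sigma> (\<Sum>j\<in>A. p j) = (\<Sum>j\<in>A. mpoly_subst \<phi> \<sigma> (p j))"
  by (induction A rule: infinite_finite_induct) (simp_all add: subst_0 subst_add)

lemma subst_Const: "mpoly_subst \<phi> \<sigma> (Const c) = \<phi> c"
  by (simp add: Const_def subst_single)

lemma subst_Var: "mpoly_subst \<phi> \<sigma> (Var i) = \<sigma> i"
proof -
  have "mpoly_subst \<phi> \<sigma> (Var i) = (\<Prod>j\<in>UNIV. if j = i then \<sigma> j else 1)"
    unfolding Var_def subst_single hom_1 mult_1
    by (intro prod.cong) (auto simp: lookup_single when_def)
  then show ?thesis by simp
qed

lemmas subst_simps = subst_0 subst_1 subst_numeral subst_add subst_diff subst_uminus subst_mult subst_power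
  subst_sum subst_Const subst_Var

lemma subst_dvd: "p dvd q \<Longrightarrow> mpoly_subst \<phi> \<sigma> p dvd mpoly_subst \<phi> \<sigma> q"
  by (auto simp: dvd_def subst_mult)

end

interpretation real_eval: real_hom "\<lambda>c::real. c"
  by unfold_locales auto

interpretation bipoly: real_hom "\<lambda>c::real. [:[:c:]:]"
  by unfold_locales (simp_all add: one_pCons)

lemma mpoly_eval_eq_subst: "mpoly_eval p x = mpoly_subst (\<lambda>c. c) (($) x) p"
  by (simp add: mpoly_eval_def mpoly_subst_def)

lemmas mpoly_eval_simps = real_eval.subst_simps[of "($) x" for x, folded mpoly_eval_eq_subst]

lemma poly_poly_subst:
  "poly (poly (mpoly_subst (\<lambda>c. [:[:c:]:]) \<sigma> p) [:t:]) s = mpoly_eval p (\<chi> i. poly (poly (\<sigma> i) [:t:]) s)"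
  by (simp add: mpoly_eval_def mpoly_subst_def poly_sum poly_prod)

text \<open>Distinct monomials are distinct characters of the multiplicative monoid of all points; hence they
  are linearly independent, by Dedekind's argument for characters.\<close>

lemma monomials_independent:
  fixes c :: "('n::finite \<Rightarrow>\<^sub>0 nat) \<Rightarrow> real"
  assumes "finite A"
    and "\<And>x :: real ^ 'n. (\<Sum>e\<in>A. c e * (\<Prod>i\<in>UNIV. (x $ i) ^ Poly_Mapping.lookup e i)) = 0"
    and "e \<in> A"
  shows "c e = 0"
  using assms
proof (induction A arbitrary: c e rule: finite_induct)
  case empty
  then show ?case by simp
next
  case (insert f A)
  define mon where "mon e x = (\<Prod>i\<in>UNIV. (x $ i) ^ Poly_Mapping.lookup e i)"
    for e :: "'n \<Rightarrow>\<^sub>0 nat" and x :: "real ^ 'n"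
  have vanish: "c f * mon f x + (\<Sum>e\<in>A. c e * mon e x) = 0" for x
    using insert.prems(1)[of x] insert.hyps by (simp add: mon_def)
  have char: "mon e (\<chi> i. x $ i * y $ i) = mon e x * mon e y" for e x y
    by (simp add: mon_def power_mult_distrib prod.distrib)
  have on_A: "c e = 0" if "e \<in> A" for e
  proof -
    have "e \<noteq> f" using that insert.hyps by auto
    then obtain i where i: "Poly_Mapping.lookup e i \<noteq> Poly_Mapping.lookup f i"
      by (metis poly_mapping_eqI)
    define y :: "real ^ 'n" where "y = (\<chi> j. if j = i then 2 else 1)"
    have y: "mon g y = 2 ^ Poly_Mapping.lookup g i" for g
    proof -
      have "mon g y = (\<Prod>j\<in>UNIV. if j = i then 2 ^ Poly_Mapping.lookup g j else 1)"
        unfolding mon_def y_def by (intro prod.cong) auto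
      then show ?thesis by simp
    qed
    \<comment> \<open>Scaling by \<open>y\<close> and subtracting \<open>mon f y\<close> times the relation removes \<open>f\<close> from it.\<close>
    have "c e * (mon e y - mon f y) = 0"
    proof (rule insert.IH[where c = "\<lambda>g. c g * (mon g y - mon f y)"])
      fix x :: "real ^ 'n"
      have "(\<Sum>e\<in>A. c e * (mon e y - mon f y) * mon e x)
          = (c f * (mon f x * mon f y) + (\<Sum>e\<in>A. c e * (mon e x * mon e y)))
            - mon f y * (c f * mon f x + (\<Sum>e\<in>A. c e * mon e x))"
        by (simp add: algebra_simps sum_subtractf sum_distrib_left)
      also have "\<dots> = 0"
        using vanish[of x] vanish[of "\<chi> i. x $ i * y $ i"] by (simp add: char)
      finally show "(\<Sum>e\<in>A. c e * (mon e y - mon f y) * (\<Prod>i\<in>UNIV. (x $ i) ^ Poly_Mapping.lookup e i)) = 0"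
        by (simp add: mon_def)
    qed (fact that)
    then show ?thesis using i by (simp add: y)
  qed
  have "c f = 0"
    using vanish[of "\<chi> i. 1"] on_A by (simp add: mon_def)
  then show ?case using on_A insert.prems(2) by auto
qed

lemma mpoly_eval_nonzero:
  assumes "p \<noteq> (0 :: 'n::finite mpoly)"
  obtains x where "mpoly_eval p x \<noteq> 0"
proof -
  obtain e where "e \<in> Poly_Mapping.keys p"
    using assms by (metis ex_in_conv keys_eq_empty)
  then show ?thesis
    using monomials_independent[of "Poly_Mapping.keys p" "Poly_Mapping.lookup p" e] that
    unfolding mpoly_eval_def by (meson finite_keys in_keys_iff)
qed

section \<open>Partial derivatives\<close>

lemma partial_deriv_superset:
  assumes "finite A" "Poly_Mapping.keys p \<subseteq> A"
  shows "partial_deriv i p = (\<Sum>e\<in>A. Poly_Mapping.single (e - Poly_Mapping.single i 1)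
    (Poly_Mapping.lookup p e * real (Poly_Mapping.lookup e i)))"
  unfolding partial_deriv_def using assms
  by (intro sum.mono_neutral_left) (auto simp: in_keys_iff)

lemma partial_deriv_single:
  "partial_deriv i (Poly_Mapping.single e c)
     = Poly_Mapping.single (e - Poly_Mapping.single i 1) (c * real (Poly_Mapping.lookup e i))"
  by (subst partial_deriv_superset[of "{e}"]) auto

lemma partial_deriv_0: "partial_deriv i 0 = 0"
  by (simp add: partial_deriv_def)

lemma partial_deriv_add: "partial_deriv i (p + q) = partial_deriv i p + partial_deriv i q"
proof -
  let ?A = "Poly_Mapping.keys p \<union> Poly_Mapping.keys q"
  have "Poly_Mapping.keys (p + q) \<subseteq> ?A" by (rule keys_add)
  then show ?thesis
    by (simp add: partial_deriv_superset[of ?A] lookup_add ring_distribs single_add sum.distrib)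
qed

lemma partial_deriv_uminus: "partial_deriv i (- p) = - partial_deriv i p"
  using partial_deriv_add[of i p "- p"] by (simp add: partial_deriv_0 add_eq_0_iff)

lemma partial_deriv_diff: "partial_deriv i (p - q) = partial_deriv i p - partial_deriv i q"
  using partial_deriv_add[of i p "- q"] by (simp add: partial_deriv_uminus)

lemma partial_deriv_sum: "partial_deriv i (\<Sum>j\<in>A. p j) = (\<Sum>j\<in>A. partial_deriv i (p j))"
  by (induction A rule: infinite_finite_induct) (simp_all add: partial_deriv_0 partial_deriv_add)

text \<open>The subtraction of exponents commutes with their addition unless it is truncated, and then the
  coefficient is zero.\<close>

lemma partial_deriv_mult_single:
  "partial_deriv i (Poly_Mapping.single e c * Poly_Mapping.single f d)
     = partial_deriv i (Poly_Mapping.single e c) * Poly_Mapping.single f d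
       + Poly_Mapping.single e c * partial_deriv i (Poly_Mapping.single f d)"
proof -
  let ?\<delta> = "Poly_Mapping.single i (1::nat)"
  have e: "e - ?\<delta> + f = e + f - ?\<delta>" if "Poly_Mapping.lookup e i \<noteq> 0" for e f :: "'a \<Rightarrow>\<^sub>0 nat"
    using that by (intro poly_mapping_eqI) (auto simp: lookup_add lookup_minus lookup_single when_def)
  have "partial_deriv i (Poly_Mapping.single e c) * Poly_Mapping.single f d
      = Poly_Mapping.single (e + f - ?\<delta>) (c * d * real (Poly_Mapping.lookup e i))"
    using e[of e f] by (cases "Poly_Mapping.lookup e i = 0")
      (simp_all add: partial_deriv_single mult_single ac_simps)
  moreover have "Poly_Mapping.single e c * partial_deriv i (Poly_Mapping.single f d)
      = Poly_Mapping.single (e + f - ?\<delta>) (c * d * real (Poly_Mapping.lookup f i))"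
    using e[of f e] by (cases "Poly_Mapping.lookup f i = 0")
      (simp_all add: partial_deriv_single mult_single ac_simps)
  ultimately show ?thesis
    by (simp add: mult_single partial_deriv_single lookup_add ring_distribs flip: single_add)
qed

lemma partial_deriv_mult:
  "partial_deriv i (p * q) = partial_deriv i p * q + p * partial_deriv i q"
proof (induction p rule: mpoly_induct)
  case (single e c)
  show ?case
  proof (induction q rule: mpoly_induct)
    case (single f d)
    show ?case by (rule partial_deriv_mult_single)
  qed (simp add: partial_deriv_add ring_distribs)
qed (simp add: partial_deriv_add ring_distribs)

lemma partial_deriv_Const: "partial_deriv i (Const c) = 0"
  by (simp add: Const_def partial_deriv_single)

lemma partial_deriv_1: "partial_deriv i 1 = 0"
  using partial_deriv_single[of i 0 1] by simp

lemma partial_deriv_Var: "partial_deriv i (Var j) = (if i = j then 1 else 0)"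
  by (auto simp: Var_def partial_deriv_single lookup_single when_def)

lemma partial_deriv_square: "partial_deriv i (p\<^sup>2) = 2 * p * partial_deriv i p"
  by (simp add: power2_eq_square partial_deriv_mult algebra_simps)

lemmas partial_deriv_simps = partial_deriv_0 partial_deriv_1 partial_deriv_add partial_deriv_diff
  partial_deriv_uminus partial_deriv_sum partial_deriv_mult partial_deriv_Const partial_deriv_Var
  partial_deriv_square

lemma partial_deriv_h_poly:
  assumes "i1 \<noteq> i2"
  shows "partial_deriv i1 (h_poly i1 i2 a) = 4 * Var i1 * ((Var i1)\<^sup>2 + (Var i2)\<^sup>2 - Const (a\<^sup>2))"
    and "partial_deriv i2 (h_poly i1 i2 a) = 4 * Var i2 * ((Var i1)\<^sup>2 + (Var i2)\<^sup>2 - Const (a\<^sup>2))"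
    and "j \<notin> {i1, i2} \<Longrightarrow> partial_deriv j (h_poly i1 i2 a) = 2 * Var j"
proof -
  have *: "(\<Sum>j\<in>UNIV - {i1, i2}. partial_deriv i ((Var j)\<^sup>2))
      = (if i \<in> {i1, i2} then 0 else 2 * Var i)" for i
  proof -
    have "(\<Sum>j\<in>UNIV - {i1, i2}. partial_deriv i ((Var j)\<^sup>2))
        = (\<Sum>j\<in>UNIV - {i1, i2}. if i = j then 2 * Var j else 0)"
      by (intro sum.cong) (auto simp: partial_deriv_simps)
    also have "\<dots> = (if i \<in> {i1, i2} then 0 else 2 * Var i)"
      by (subst sum.delta') auto
    finally show ?thesis .
  qed
  have d: "partial_deriv i (h_poly i1 i2 a) =
      2 * ((Var i1)\<^sup>2 + (Var i2)\<^sup>2 - Const (a\<^sup>2))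
        * (2 * Var i1 * (if i = i1 then 1 else 0) + 2 * Var i2 * (if i = i2 then 1 else 0))
       + (if i \<in> {i1, i2} then 0 else 2 * Var i)" for i
    unfolding h_poly_def partial_deriv_diff partial_deriv_add partial_deriv_sum * partial_deriv_1
    by (simp add: partial_deriv_simps)
  show "partial_deriv i1 (h_poly i1 i2 a) = 4 * Var i1 * ((Var i1)\<^sup>2 + (Var i2)\<^sup>2 - Const (a\<^sup>2))"
    "partial_deriv i2 (h_poly i1 i2 a) = 4 * Var i2 * ((Var i1)\<^sup>2 + (Var i2)\<^sup>2 - Const (a\<^sup>2))"
    "j \<notin> {i1, i2} \<Longrightarrow> partial_deriv j (h_poly i1 i2 a) = 2 * Var j"
    using assms by (auto simp: d algebra_simps)
qed

lemma sum_UNIV_split2: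
  fixes f :: "'n::finite \<Rightarrow> 'b::comm_monoid_add"
  assumes "i1 \<noteq> i2"
  shows "(\<Sum>i\<in>UNIV. f i) = f i1 + f i2 + (\<Sum>i\<in>UNIV - {i1, i2}. f i)"
proof -
  have "(\<Sum>i\<in>UNIV. f i) = (\<Sum>i\<in>{i1, i2}. f i) + (\<Sum>i\<in>UNIV - {i1, i2}. f i)"
    by (metis add.commute finite subset_UNIV sum.subset_diff)
  then show ?thesis using assms by simp
qed

lemma vf_apply_h_poly:
  fixes i1 i2 :: "'n::finite"
  assumes "i1 \<noteq> i2"
  shows "vf_apply R (h_poly i1 i2 a) =
    4 * ((Var i1)\<^sup>2 + (Var i2)\<^sup>2 - Const (a\<^sup>2)) * (Var i1 * R i1 + Var i2 * R i2)
      + 2 * (\<Sum>j\<in>UNIV - {i1, i2}. Var j * R j)"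
  unfolding vf_apply_def sum_UNIV_split2[OF assms]
  by (simp add: partial_deriv_h_poly[OF assms] algebra_simps sum_distrib_left)

text \<open>The hyperplanes through the meridians form the pencil with axis \<open>x\<^sub>1 = x\<^sub>2 = 0\<close>.\<close>

definition pencil_form :: "'n \<Rightarrow> 'n \<Rightarrow> real \<Rightarrow> real \<Rightarrow> 'n mpoly" where
  "pencil_form i1 i2 \<alpha> \<beta> = Const \<alpha> * Var i1 + Const \<beta> * Var i2"

lemma vf_apply_pencil_form:
  fixes i1 i2 :: "'n::finite"
  assumes "i1 \<noteq> i2"
  shows "vf_apply R (pencil_form i1 i2 \<alpha> \<beta>) = Const \<alpha> * R i1 + Const \<beta> * R i2"
proof -
  have "(\<Sum>i\<in>UNIV - {i1, i2}. R i * partial_deriv i (pencil_form i1 i2 \<alpha> \<beta>)) = 0"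
    by (intro sum.neutral) (auto simp: pencil_form_def partial_deriv_simps)
  then show ?thesis
    unfolding vf_apply_def sum_UNIV_split2[OF assms] using assms
    by (simp add: pencil_form_def partial_deriv_simps algebra_simps)
qed

section \<open>The bound on the multiplicities of invariant hyperplanes\<close>

lemma degree_mpoly_subst_le:
  fixes \<sigma> :: "'n::finite \<Rightarrow> real poly poly"
  assumes "\<And>i. degree (\<sigma> i) \<le> 1"
  shows "degree (mpoly_subst (\<lambda>c. [:[:c:]:]) \<sigma> p) \<le> total_degree p"
  unfolding mpoly_subst_def
proof (rule degree_sum_le)
  fix e assume e: "e \<in> Poly_Mapping.keys p"
  have "degree (\<Prod>i\<in>UNIV. \<sigma> i ^ Poly_Mapping.lookup e i)
      \<le> (\<Sum>i\<in>UNIV. degree (\<sigma> i ^ Poly_Mapping.lookup e i))"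
    using degree_prod_sum_le[of UNIV "\<lambda>i. \<sigma> i ^ Poly_Mapping.lookup e i"] by (simp add: o_def)
  also have "\<dots> \<le> (\<Sum>i\<in>UNIV. Poly_Mapping.lookup e i)"
  proof (rule sum_mono)
    fix i
    have "degree (\<sigma> i ^ Poly_Mapping.lookup e i) \<le> degree (\<sigma> i) * Poly_Mapping.lookup e i"
      by (rule degree_power_le)
    also have "\<dots> \<le> Poly_Mapping.lookup e i" using assms[of i] by simp
    finally show "degree (\<sigma> i ^ Poly_Mapping.lookup e i) \<le> Poly_Mapping.lookup e i" .
  qed
  also have "\<dots> \<le> total_degree p"
    unfolding total_degree_def using e by (intro Max_ge) auto
  finally show "degree ([:[:Poly_Mapping.lookup p e:]:] * (\<Prod>i\<in>UNIV. \<sigma> i ^ Poly_Mapping.lookup e i))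
      \<le> total_degree p"
    by (auto intro: order_trans[OF degree_mult_le])
qed simp

text \<open>After the substitution below, the coefficient of \<open>t\<^sup>d\<close> is the dehomogenisation of a form of degree \<open>d\<close>
  in the first two coordinates,
  and hence has degree at most \<open>d\<close> in \<open>s\<close>.\<close>

definition cone_poly :: "real poly poly \<Rightarrow> bool" where
  "cone_poly p \<longleftrightarrow> (\<forall>d. degree (coeff p d) \<le> d)"

lemma cone_poly_const: "cone_poly [:[:c:]:]"
  by (auto simp: cone_poly_def coeff_pCons split: nat.splits)

lemma cone_poly_add: "cone_poly p \<Longrightarrow> cone_poly q \<Longrightarrow> cone_poly (p + q)"
  by (auto simp: cone_poly_def intro: degree_add_le)

lemma cone_poly_mult:
  assumes "cone_poly p" "cone_poly q"
  shows "cone_poly (p * q)"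
  unfolding cone_poly_def coeff_mult
proof (intro allI degree_sum_le)
  fix d i :: nat assume i: "i \<in> {..d}"
  have "degree (coeff p i * coeff q (d - i)) \<le> degree (coeff p i) + degree (coeff q (d - i))"
    by (rule degree_mult_le)
  also have "\<dots> \<le> i + (d - i)"
    using assms unfolding cone_poly_def by (intro add_mono) auto
  finally show "degree (coeff p i * coeff q (d - i)) \<le> d" using i by simp
qed simp

lemma cone_poly_subst:
  assumes "\<And>i. cone_poly (\<sigma> i)"
  shows "cone_poly (mpoly_subst (\<lambda>c. [:[:c:]:]) \<sigma> p)"
proof -
  have 1: "cone_poly 1" using cone_poly_const[of 1] by (simp add: one_pCons)
  have pow: "cone_poly (\<sigma> i ^ k)" for i k
    by (induction k) (auto intro: 1 cone_poly_mult assms)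
  have prod: "cone_poly (\<Prod>i\<in>B. \<sigma> i ^ Poly_Mapping.lookup e i)" for B e
    by (induction B rule: infinite_finite_induct) (auto intro: 1 pow cone_poly_mult)
  have "cone_poly (\<Sum>e\<in>B. [:[:Poly_Mapping.lookup p e:]:] * (\<Prod>i\<in>UNIV. \<sigma> i ^ Poly_Mapping.lookup e i))" for B
  proof (induction B rule: infinite_finite_induct)
    case (insert e B)
    then show ?case
      unfolding sum.insert[OF insert.hyps]
      by (intro cone_poly_add cone_poly_mult cone_poly_const prod)
  qed (use cone_poly_const[of 0] in simp_all)
  then show ?thesis by (simp add: mpoly_subst_def)
qed

lemma coeff_monom_1_mult: "coeff (monom c 1 * p) (Suc d) = c * coeff p d"
  by (simp add: coeff_monom_mult)

text \<open>This is where tangency to the hypersurface enters. Here \<open>\<omega> t\<^sup>2\<close> is \<open>x\<^sub>1\<^sup>2 + x\<^sub>2\<^sup>2\<close>, \<open>A\<close> is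
  \<open>x\<^sub>1R\<^sub>1 + x\<^sub>2R\<^sub>2\<close> and \<open>D\<close> collects the contributions of the other coordinates, which are held constant.
  The left side has degree at most \<open>m + 3\<close> in \<open>t\<close> and \<open>h\<close> has degree 4, so \<open>K\<close> has degree below \<open>m\<close>.
  In the coefficient of \<open>t\<close> to the power \<open>d + 2\<close> with \<open>d \<ge> m\<close>, only the leading term \<open>\<omega>\<^sup>2 t\<^sup>4\<close> of \<open>h\<close> can
  therefore meet a nonzero coefficient of \<open>K\<close>, while the left side reduces to \<open>4 \<omega>\<close> times the coefficient of \<open>t\<^sup>d\<close> in \<open>A\<close>;
  one factor \<open>\<omega>\<close> cancels and one remains.\<close>

lemma dvd_top_coeffs_of_tangency:
  fixes A D K :: "real poly poly" and \<omega> :: "real poly"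
  assumes "\<omega> \<noteq> 0"
    and eq: "4 * (monom \<omega> 2 - [:[:b:]:]) * A + D = K * ((monom \<omega> 2 - [:[:b:]:])\<^sup>2 + [:[:\<kappa>:]:])"
    and "degree A \<le> m + 1" "degree D \<le> m" "m \<le> d"
  shows "\<omega> dvd coeff A d"
proof -
  define H where "H = (monom \<omega> 2 - [:[:b:]:])\<^sup>2 + [:[:\<kappa>:]:]"
  have H: "H = monom (\<omega>\<^sup>2) 4 - monom (smult (2 * b) \<omega>) 2 + [:[:b\<^sup>2 + \<kappa>:]:]"
  proof -
    have "monom (smult (2 * b) \<omega>) 2 = 2 * [:[:b:]:] * monom \<omega> 2"
      by (intro poly_eqI) (auto simp: numeral_poly smult_add_left)
    moreover have "monom (\<omega>\<^sup>2) 4 = monom \<omega> 2 * monom \<omega> 2"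
      by (simp add: mult_monom power2_eq_square)
    ultimately show ?thesis
      by (simp add: H_def power2_eq_square algebra_simps)
  qed
  have "degree H = 4"
  proof (rule antisym)
    show "degree H \<le> 4"
      unfolding H by (intro degree_add_le degree_diff_le order_trans[OF degree_monom_le]) auto
    have "coeff H 4 = \<omega>\<^sup>2" by (simp add: H coeff_pCons)
    then show "4 \<le> degree H" using assms(1) by (intro le_degree) auto
  qed
  have lhs: "degree (4 * (monom \<omega> 2 - [:[:b:]:]) * A + D) \<le> m + 3"
  proof (intro degree_add_le)
    have "degree (4 * (monom \<omega> 2 - [:[:b:]:])) \<le> 2"
      by (rule order_trans[OF degree_mult_le])
        (auto simp: numeral_poly intro!: degree_diff_le order_trans[OF degree_monom_le])
    then show "degree (4 * (monom \<omega> 2 - [:[:b:]:]) * A) \<le> m + 3"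
      using assms(3) order_trans[OF degree_mult_le, of "4 * (monom \<omega> 2 - [:[:b:]:])" A "m + 3"]
      by linarith
  qed (use assms in auto)
  have K: "coeff K e = 0" if "m \<le> e" for e
  proof (cases "K = 0")
    case False
    moreover have "H \<noteq> 0" using \<open>degree H = 4\<close> by auto
    ultimately have "degree (K * H) = degree K + 4"
      using \<open>degree H = 4\<close> by (simp add: degree_mult_eq)
    then have "degree K + 4 \<le> m + 3" using lhs eq by (simp add: H_def)
    then show ?thesis using that by (intro coeff_eq_0) auto
  qed simp
  have "coeff A (d + 2) = 0" using assms by (intro coeff_eq_0) auto
  then have UA: "coeff ((monom \<omega> 2 - [:[:b:]:]) * A) (d + 2) = \<omega> * coeff A d"
    by (simp add: left_diff_distrib coeff_monom_mult)
  have "K * H = smult 4 ((monom \<omega> 2 - [:[:b:]:]) * A) + D"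
    using eq unfolding H_def[symmetric] by (simp add: numeral_poly)
  then have "coeff (K * H) (d + 2) = 4 * coeff ((monom \<omega> 2 - [:[:b:]:]) * A) (d + 2) + coeff D (d + 2)"
    by (simp only: coeff_add coeff_smult)
  moreover have "coeff D (d + 2) = 0" using assms by (intro coeff_eq_0) auto
  ultimately have "coeff (K * H) (d + 2) = 4 * (\<omega> * coeff A d)"
    by (simp only: UA add_0_right)
  moreover have "coeff (K * H) (d + 2) =
      (if d < 2 then 0 else \<omega>\<^sup>2 * coeff K (d - 2)) - smult (2 * b) \<omega> * coeff K d
        + smult (b\<^sup>2 + \<kappa>) (coeff K (d + 2))"
    unfolding H mult.commute[of K]
    by (auto simp: distrib_right left_diff_distrib coeff_monom_mult)
  ultimately have "4 * (\<omega> * coeff A d) = (if d < 2 then 0 else \<omega>\<^sup>2 * coeff K (d - 2))"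
    using K[of d] K[of "d + 2"] assms(5) by simp
  then have "\<omega> * (4 * coeff A d) = \<omega> * (if d < 2 then 0 else \<omega> * coeff K (d - 2))"
    by (auto simp: power2_eq_square algebra_simps)
  then have "4 * coeff A d = (if d < 2 then 0 else \<omega> * coeff K (d - 2))"
    using assms(1) unfolding mult_cancel_left by blast
  then have "\<omega> dvd smult 4 (coeff A d)" by (auto simp: numeral_poly)
  then show ?thesis by (simp add: dvd_smult_iff)
qed

lemma prod_coprime_dvd:
  fixes f :: "'i \<Rightarrow> 'a::semiring_gcd"
  assumes "\<And>i. i \<in> I \<Longrightarrow> f i dvd c"
    and "\<And>i j. i \<in> I \<Longrightarrow> j \<in> I \<Longrightarrow> i \<noteq> j \<Longrightarrow> coprime (f i) (f j)"
  shows "(\<Prod>i\<in>I. f i) dvd c"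
  using assms
proof (induction I rule: infinite_finite_induct)
  case (insert i I)
  have "coprime (f i) (\<Prod>j\<in>I. f j)"
    using insert by (intro prod_coprime_right) auto
  then show ?case using insert by (auto intro!: divides_mult)
qed auto

lemma coprime_linear_polys:
  fixes p q p' q' :: real
  assumes "p * q' - p' * q \<noteq> 0"
  shows "coprime [:p, q:] [:p', q':]"
proof (rule coprimeI)
  fix c assume c: "c dvd [:p, q:]" "c dvd [:p', q':]"
  have "c dvd smult q' [:p, q:] - smult q [:p', q':]"
    using c by (intro dvd_diff dvd_smult)
  also have "\<dots> = [:p * q' - p' * q:]" by (simp add: algebra_simps)
  also have "\<dots> dvd 1" using assms by (simp add: is_unit_const_poly_iff dvd_field_iff)
  finally show "is_unit c" .
qed

lemma coprime_circle_linear: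
  fixes p q :: real
  assumes "q \<noteq> 0"
  shows "coprime [:1, 0, 1:] [:p, q:]"
proof (rule coprimeI)
  fix c assume c: "c dvd [:1, 0, 1:]" "c dvd [:p, q:]"
  have "c dvd smult (q\<^sup>2) [:1, 0, 1:] - [:p, q:] * [:- p, q:]"
    using c by (intro dvd_diff dvd_smult dvd_mult2)
  also have "\<dots> = [:p\<^sup>2 + q\<^sup>2:]" by (simp add: power2_eq_square)
  also have "\<dots> dvd 1"
    using assms by (simp add: is_unit_const_poly_iff dvd_field_iff sum_power2_eq_zero_iff)
  finally show "is_unit c" .
qed

text \<open>Up to scaling, a rotation of the first two coordinates by an angle of tangent \<open>- l\<close>, composed with the chart
  \<open>(t, s) \<mapsto> (t, t s)\<close>. In the new coordinates the hyperplane \<open>\<alpha>x\<^sub>1 + \<beta>x\<^sub>2 = 0\<close> becomes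
  \<open>t ((\<alpha> - l \<beta>) + (\<alpha> l + \<beta>) s) = 0\<close>, whose factor in \<open>s\<close> has degree exactly 1 for all but at most one value of \<open>l\<close>.\<close>

definition chart :: "'n \<Rightarrow> 'n \<Rightarrow> real \<Rightarrow> ('n \<Rightarrow> real) \<Rightarrow> 'n \<Rightarrow> real poly poly" where
  "chart i1 i2 l c j =
     (if j = i1 then monom [:1, l:] 1 else if j = i2 then monom [:- l, 1:] 1 else [:[:c j:]:])"

lemma degree_chart: "degree (chart i1 i2 l c j) \<le> 1"
  by (auto simp: chart_def intro: degree_monom_le)

lemma cone_poly_chart: "cone_poly (chart i1 i2 l c j)"
  by (auto simp: chart_def cone_poly_const) (auto simp: cone_poly_def)

text \<open>The extactic polynomial \<open>E = x\<^sub>1R\<^sub>2 - x\<^sub>2R\<^sub>1\<close> has degree at most \<open>m + 1\<close> in \<open>t\<close>, so counting linear factors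
  in a nonzero coefficient of \<open>E\<close> gives \<open>m + 1\<close> directly. The improvement by 2 comes from the extra factor
  \<open>1 + s\<^sup>2\<close>, prime to all linear factors, in the coefficients of degree \<open>m\<close> and \<open>m + 1\<close>. A coefficient of
  degree \<open>d < m\<close> has at most \<open>d\<close> linear factors.\<close>

lemma sum_pencil_multiplicities_le:
  fixes i1 i2 :: "'n::finite" and \<alpha> \<beta> :: "'i \<Rightarrow> real"
  assumes "i1 \<noteq> i2" and deg: "vf_degree R \<le> m" and tangent: "vf_on_S i1 i2 a R"
    and nz: "extactic i1 i2 R \<noteq> 0"
    and "finite I"
    and form: "\<And>i. i \<in> I \<Longrightarrow> (\<alpha> i, \<beta> i) \<noteq> (0, 0)"
    and indep: "\<And>i j. i \<in> I \<Longrightarrow> j \<in> I \<Longrightarrow> i \<noteq> j \<Longrightarrow> \<alpha> i * \<beta> j - \<alpha> j * \<beta> i \<noteq> 0"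
    and dvd: "\<And>i. i \<in> I \<Longrightarrow> pencil_form i1 i2 (\<alpha> i) (\<beta> i) ^ \<mu> i dvd extactic i1 i2 R"
  shows "(\<Sum>i\<in>I. \<mu> i) \<le> m - 1"
proof -
  obtain x where x: "mpoly_eval (extactic i1 i2 R) x \<noteq> 0"
    using mpoly_eval_nonzero[OF nz] .
  then have x12: "x $ i1 \<noteq> 0 \<or> x $ i2 \<noteq> 0"
    by (auto simp: extactic_def mpoly_eval_simps)
  \<comment> \<open>The first condition puts the point \<open>x\<close> into the image of the chart, the second makes the
      factors in \<open>s\<close> of all forms linear.\<close>
  obtain l where l: "x $ i1 - l * x $ i2 \<noteq> 0" "\<And>i. i \<in> I \<Longrightarrow> \<alpha> i * l + \<beta> i \<noteq> 0"
  proof -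
    have fin: "finite ({l. x $ i1 - l * x $ i2 = 0} \<union> (\<Union>i\<in>I. {l. \<alpha> i * l + \<beta> i = 0}))"
    proof -
      have *: "finite {l. p * l + q = 0}" if "(p, q) \<noteq> (0, 0)" for p q :: real
        by (rule finite_subset[of _ "{- q / p}"]) (use that in \<open>auto simp: add_eq_0_iff divide_simps mult.commute\<close>)
      have "finite {l. x $ i1 - l * x $ i2 = 0}"
        using *[of "- x $ i2" "x $ i1"] x12 by (auto simp: algebra_simps)
      then show ?thesis using * form \<open>finite I\<close> by auto
    qed
    obtain l where "l \<notin> {l. x $ i1 - l * x $ i2 = 0} \<union> (\<Union>i\<in>I. {l. \<alpha> i * l + \<beta> i = 0})"
      using ex_new_if_finite[OF infinite_UNIV_char_0 fin] by blast
    then show ?thesis using that by auto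
  qed
  define \<sigma> where "\<sigma> = chart i1 i2 l (($) x)"
  let ?S = "mpoly_subst (\<lambda>c. [:[:c:]:]) \<sigma>"
  define E A where "E = ?S (extactic i1 i2 R)" and "A = ?S (Var i1 * R i1 + Var i2 * R i2)"
  define \<omega> :: "real poly" where "\<omega> = smult (1 + l\<^sup>2) [:1, 0, 1:]"
  have l_pos: "1 + l\<^sup>2 \<noteq> 0" using sum_power2_eq_zero_iff[of 1 l] by simp
  have \<omega>0: "\<omega> \<noteq> 0" using l_pos by (simp add: \<omega>_def)
  have \<sigma>12: "\<sigma> i1 = monom [:1, l:] 1" "\<sigma> i2 = monom [:- l, 1:] 1"
    using \<open>i1 \<noteq> i2\<close> by (auto simp: \<sigma>_def chart_def)
  have circle: "\<sigma> i1 ^ 2 + \<sigma> i2 ^ 2 = monom \<omega> 2"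
    by (simp add: \<sigma>12 \<omega>_def power2_eq_square mult_monom add_monom algebra_simps numeral_2_eq_2)
  have degR: "degree (?S (R j)) \<le> m" for j
  proof -
    have "total_degree (R j) \<le> vf_degree R" unfolding vf_degree_def by (intro Max_ge) auto
    moreover have "degree (?S (R j)) \<le> total_degree (R j)"
      by (rule degree_mpoly_subst_le) (unfold \<sigma>_def, rule degree_chart)
    ultimately show ?thesis using deg by linarith
  qed
  have degxR: "degree (\<sigma> i * ?S (R j)) \<le> m + 1" for i j
    using degree_mult_le[of "\<sigma> i" "?S (R j)"] degR[of j] degree_chart[of i1 i2 l "($) x" i]
    by (simp add: \<sigma>_def)
  have E: "E = \<sigma> i1 * ?S (R i2) - \<sigma> i2 * ?S (R i1)"
    and A: "A = \<sigma> i1 * ?S (R i1) + \<sigma> i2 * ?S (R i2)"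
    by (simp_all add: E_def A_def extactic_def bipoly.subst_simps)
  have degE: "degree E \<le> m + 1" and degA: "degree A \<le> m + 1"
    unfolding E A by (intro degree_diff_le degree_add_le degxR)+
  have "E \<noteq> 0"
  proof
    assume "E = 0"
    define t where "t = (x $ i1 - l * x $ i2) / (1 + l\<^sup>2)"
    define s where "s = (l * x $ i1 + x $ i2) / (x $ i1 - l * x $ i2)"
    have t: "(1 + l\<^sup>2) * t = x $ i1 - l * x $ i2"
      using l_pos by (simp add: t_def)
    have ts: "(1 + l\<^sup>2) * (t * s) = l * x $ i1 + x $ i2"
      using l(1) l_pos by (simp add: t_def s_def)
    have "(1 + l\<^sup>2) * (t + l * (t * s)) = (1 + l\<^sup>2) * t + l * ((1 + l\<^sup>2) * (t * s))"
      by (simp add: algebra_simps)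
    also have "\<dots> = (1 + l\<^sup>2) * x $ i1"
      unfolding t ts by (simp add: algebra_simps power2_eq_square)
    finally have x1: "t + l * (t * s) = x $ i1"
      unfolding mult_left_cancel[OF l_pos] .
    have "(1 + l\<^sup>2) * (t * s - l * t) = (1 + l\<^sup>2) * (t * s) - l * ((1 + l\<^sup>2) * t)"
      by (simp add: algebra_simps)
    also have "\<dots> = (1 + l\<^sup>2) * x $ i2"
      unfolding t ts by (simp add: algebra_simps power2_eq_square)
    finally have x2: "t * s - l * t = x $ i2"
      unfolding mult_left_cancel[OF l_pos] .
    from x1 x2 have "(\<chi> j. poly (poly (\<sigma> j) [:t:]) s) = x"
      by (auto simp: vec_eq_iff \<sigma>_def chart_def poly_monom algebra_simps)
    then have "mpoly_eval (extactic i1 i2 R) x = poly (poly E [:t:]) s"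
      by (simp add: E_def poly_poly_subst)
    then show False using x \<open>E = 0\<close> by simp
  qed
  then obtain d where d: "coeff E d \<noteq> 0" by (metis leading_coeff_0_iff)
  then have "d \<le> m + 1" using degE le_degree order_trans by blast
  have "cone_poly E"
    unfolding E_def by (rule cone_poly_subst) (simp add: \<sigma>_def cone_poly_chart)
  then have dd: "degree (coeff E d) \<le> d" by (simp add: cone_poly_def)

  define lin where "lin i = [:\<alpha> i - l * \<beta> i, \<alpha> i * l + \<beta> i:]" for i
  have lin_dvd: "lin i ^ \<mu> i dvd coeff E d" if "i \<in> I" for i
  proof -
    have "?S (pencil_form i1 i2 (\<alpha> i) (\<beta> i)) = [:lin i:] * monom 1 1"
      by (simp add: pencil_form_def bipoly.subst_simps \<sigma>12 lin_def smult_monom add_monom algebra_simps)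
    then have "([:lin i:] * monom 1 1) ^ \<mu> i dvd E"
      unfolding E_def using bipoly.subst_dvd[OF dvd[OF that], of \<sigma>] by (simp add: bipoly.subst_simps)
    then have "[:lin i ^ \<mu> i:] dvd E"
      by (metis dvd_mult_left poly_const_pow power_mult_distrib)
    then show ?thesis by (simp add: const_poly_dvd_iff)
  qed
  have prod_dvd: "(\<Prod>i\<in>I. lin i ^ \<mu> i) dvd coeff E d"
  proof (rule prod_coprime_dvd)
    fix i j assume ij: "i \<in> I" "j \<in> I" "i \<noteq> j"
    have "(\<alpha> i - l * \<beta> i) * (\<alpha> j * l + \<beta> j) - (\<alpha> j - l * \<beta> j) * (\<alpha> i * l + \<beta> i)
        = (1 + l\<^sup>2) * (\<alpha> i * \<beta> j - \<alpha> j * \<beta> i)"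
      by (simp add: algebra_simps power2_eq_square)
    then have "coprime (lin i) (lin j)"
      unfolding lin_def using l_pos indep[OF ij] by (intro coprime_linear_polys) simp
    then show "coprime (lin i ^ \<mu> i) (lin j ^ \<mu> j)" by simp
  qed (rule lin_dvd)
  have lin_deg: "degree (lin i) = 1" "lin i \<noteq> 0" if "i \<in> I" for i
    using l(2)[OF that] by (auto simp: lin_def)
  have deg_prod: "degree (\<Prod>i\<in>I. lin i ^ \<mu> i) = (\<Sum>i\<in>I. \<mu> i)"
    using lin_deg by (subst degree_prod_eq_sum_degree) (auto simp: degree_power_eq)

  show ?thesis
  proof (cases "d < m")
    case True
    have "degree (\<Prod>i\<in>I. lin i ^ \<mu> i) \<le> degree (coeff E d)"
      using prod_dvd d by (rule dvd_imp_degree_le)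
    then show ?thesis using True dd deg_prod by simp
  next
    case False
    then have "d \<ge> m" by simp
    obtain K where K: "vf_apply R (h_poly i1 i2 a) = K * h_poly i1 i2 a"
      using tangent by (auto simp: vf_on_S_def)
    define D where "D = 2 * (\<Sum>j\<in>UNIV - {i1, i2}. \<sigma> j * ?S (R j))"
    have const: "\<sigma> j = [:[:x $ j:]:]" if "j \<in> UNIV - {i1, i2}" for j
      using that by (simp add: \<sigma>_def chart_def)
    have degD: "degree D \<le> m"
    proof -
      have "D = smult 2 (\<Sum>j\<in>UNIV - {i1, i2}. smult [:x $ j:] (?S (R j)))"
        using const by (simp add: D_def numeral_poly)
      also have "degree \<dots> \<le> m"
        by (intro order_trans[OF degree_smult_le] degree_sum_le) (auto intro: degR)
      finally show ?thesis .
    qed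
    have sq: "(\<Sum>j\<in>UNIV - {i1, i2}. (\<sigma> j)\<^sup>2) = [:[:\<Sum>j\<in>UNIV - {i1, i2}. (x $ j)\<^sup>2:]:]"
    proof -
      have "(\<Sum>j\<in>UNIV - {i1, i2}. (\<sigma> j)\<^sup>2) = (\<Sum>j\<in>UNIV - {i1, i2}. [:[:(x $ j)\<^sup>2:]:])"
        using const by (intro sum.cong) (simp_all add: poly_const_pow)
      also have "\<dots> = [:[:\<Sum>j\<in>UNIV - {i1, i2}. (x $ j)\<^sup>2:]:]"
        by (simp only: bipoly.hom_sum)
      finally show ?thesis .
    qed
    have "?S (vf_apply R (h_poly i1 i2 a)) = ?S K * ?S (h_poly i1 i2 a)"
      by (simp add: K bipoly.subst_mult)
    moreover have "?S (vf_apply R (h_poly i1 i2 a)) = 4 * (monom \<omega> 2 - [:[:a\<^sup>2:]:]) * A + D"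
      by (simp only: vf_apply_h_poly[OF \<open>i1 \<noteq> i2\<close>] bipoly.subst_simps A D_def circle)
    moreover have "?S (h_poly i1 i2 a) = (monom \<omega> 2 - [:[:a\<^sup>2:]:])\<^sup>2
        + [:[:(\<Sum>j\<in>UNIV - {i1, i2}. (x $ j)\<^sup>2) - 1:]:]"
      by (simp add: h_poly_def bipoly.subst_simps circle sq one_pCons)
    ultimately have "\<omega> dvd coeff A d"
      using dvd_top_coeffs_of_tangency[OF \<omega>0 _ degA degD \<open>d \<ge> m\<close>] by simp
    \<comment> \<open>The rotated pair \<open>(A, E)\<close> determines \<open>(R\<^sub>1, R\<^sub>2)\<close> up to the factor \<open>x\<^sub>1\<^sup>2 + x\<^sub>2\<^sup>2\<close>, which
        transfers the divisibility from \<open>A\<close> to \<open>E\<close>.\<close>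
    have R2: "\<sigma> i1 * E + \<sigma> i2 * A = monom \<omega> 2 * ?S (R i2)"
      and R1: "\<sigma> i1 * A - \<sigma> i2 * E = monom \<omega> 2 * ?S (R i1)"
      unfolding circle[symmetric] E A by (simp_all add: algebra_simps power2_eq_square)
    have top: "\<omega> dvd coeff (monom \<omega> 2 * p) k" for p k by (simp add: coeff_monom_mult)
    have "\<omega> dvd coeff (\<sigma> i1 * E + \<sigma> i2 * A) (Suc d)" unfolding R2 by (rule top)
    moreover have "\<omega> dvd coeff (\<sigma> i1 * A - \<sigma> i2 * E) (Suc d)" unfolding R1 by (rule top)
    ultimately have "\<omega> dvd [:1, l:] * coeff E d" "\<omega> dvd [:- l, 1:] * coeff E d"
      using \<open>\<omega> dvd coeff A d\<close>
      unfolding \<sigma>12 coeff_add coeff_diff coeff_monom_1_mult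
      by (metis dvd_add_left_iff dvd_mult, metis dvd_diff_right_iff dvd_mult)
    then have "\<omega> dvd [:1, l:] * coeff E d - smult l ([:- l, 1:] * coeff E d)"
      by (intro dvd_diff dvd_smult)
    also have "\<dots> = smult (1 + l\<^sup>2) (coeff E d)"
      by (simp add: algebra_simps power2_eq_square smult_add_left smult_diff_right)
    finally have "\<omega> dvd coeff E d" using l_pos by (simp add: dvd_smult_iff)
    then have "[:1, 0, 1:] dvd coeff E d" using smult_dvd_cancel unfolding \<omega>_def by blast
    moreover have "coprime [:1, 0, 1:] (\<Prod>i\<in>I. lin i ^ \<mu> i)"
      unfolding lin_def using l(2)
      by (intro prod_coprime_right coprime_power_right_iff[THEN iffD2] disjI1 coprime_circle_linear) auto
    ultimately have "[:1, 0, 1:] * (\<Prod>i\<in>I. lin i ^ \<mu> i) dvd coeff E d"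
      using prod_dvd by (intro divides_mult)
    then have "degree ([:1, 0, 1:] * (\<Prod>i\<in>I. lin i ^ \<mu> i)) \<le> degree (coeff E d)"
      using d by (rule dvd_imp_degree_le)
    moreover have "degree ([:1, 0, 1:] * (\<Prod>i\<in>I. lin i ^ \<mu> i)) = 2 + (\<Sum>i\<in>I. \<mu> i)"
      using lin_deg \<open>finite I\<close> by (subst degree_mult_eq) (auto simp: deg_prod)
    ultimately show ?thesis using dd \<open>d \<le> m + 1\<close> by linarith
  qed
qed

section \<open>The two meridians in a hyperplane\<close>

lemma eval_pencil_form: "mpoly_eval (pencil_form i1 i2 \<alpha> \<beta>) x = \<alpha> * x $ i1 + \<beta> * x $ i2"
  by (simp add: pencil_form_def mpoly_eval_simps)

lemma mem_S_surface:
  "x \<in> S_surface i1 i2 a \<longleftrightarrow>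
     ((x $ i1)\<^sup>2 + (x $ i2)\<^sup>2 - a\<^sup>2)\<^sup>2 + (\<Sum>j\<in>UNIV - {i1, i2}. (x $ j)\<^sup>2) = 1"
  by (simp add: S_surface_def zero_set_def h_poly_def mpoly_eval_simps)

lemma meridian_forms_iff:
  "g \<in> meridian_forms i1 i2 \<longleftrightarrow> (\<exists>\<alpha> \<beta>. g = pencil_form i1 i2 \<alpha> \<beta> \<and> (\<alpha>, \<beta>) \<noteq> (0, 0))"
  by (auto simp: meridian_forms_def pencil_form_def)

lemma pencil_form_scale: "pencil_form i1 i2 (c * \<alpha>) (c * \<beta>) = Const c * pencil_form i1 i2 \<alpha> \<beta>"
  by (simp add: pencil_form_def Const_def mult_single ring_distribs flip: mult.assoc)

lemma axis_free:
  assumes "x \<in> S_surface i1 i2 a" "a > 1"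
  shows "x $ i1 \<noteq> 0 \<or> x $ i2 \<noteq> 0"
proof (rule ccontr)
  assume "\<not> ?thesis"
  then have "(a\<^sup>2)\<^sup>2 + (\<Sum>j\<in>UNIV - {i1, i2}. (x $ j)\<^sup>2) = 1"
    using assms(1) by (simp add: mem_S_surface)
  moreover have "(\<Sum>j\<in>UNIV - {i1, i2}. (x $ j)\<^sup>2) \<ge> 0" by (intro sum_nonneg) simp
  moreover have "(a\<^sup>2)\<^sup>2 > 1" using assms(2) by (intro power_strict_mono[of 1, simplified]) (auto intro: one_less_power)
  ultimately show False by linarith
qed

definition half_meridian :: "'n::finite \<Rightarrow> 'n \<Rightarrow> real \<Rightarrow> real \<Rightarrow> real \<Rightarrow> (real ^ 'n) set" where
  "half_meridian i1 i2 a \<alpha> \<beta> =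
     {x \<in> S_surface i1 i2 a. \<alpha> * x $ i1 + \<beta> * x $ i2 = 0 \<and> \<alpha> * x $ i2 - \<beta> * x $ i1 > 0}"

text \<open>On this half, the position is determined by the radius \<open>\<rho>\<close> in the first two coordinates and the
  remaining coordinates \<open>y\<close>, with \<open>(\<rho>\<^sup>2 - a\<^sup>2)\<^sup>2 = 1 - |y|\<^sup>2\<close>. It is thus the union of two graphs over the
  unit ball of the \<open>y\<close>, one for each sign \<open>\<tau>\<close> of \<open>\<rho>\<^sup>2 - a\<^sup>2\<close>, which are glued along the unit sphere; the sphere is
  nonempty because there is a third coordinate. The condition \<open>a > 1\<close> keeps \<open>\<rho>\<close> positive.\<close>

lemma half_meridian_connected_nonempty:
  fixes i1 i2 :: "'n::finite"
  assumes "i1 \<noteq> i2" "a > 1" "(\<alpha>, \<beta>) \<noteq> (0, 0)" and third: "\<exists>j. j \<notin> {i1, i2}"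
  shows "connected (half_meridian i1 i2 a \<alpha> \<beta>)" "half_meridian i1 i2 a \<alpha> \<beta> \<noteq> {}"
proof -
  define N where "N = \<alpha>\<^sup>2 + \<beta>\<^sup>2"
  have N: "N > 0" using assms(3) by (auto simp: N_def sum_power2_gt_zero_iff)
  define D :: "(real ^ 'n) set" where "D = {y. y $ i1 = 0} \<inter> {y. y $ i2 = 0} \<inter> cball 0 1"
  define \<rho> where "\<rho> \<tau> y = sqrt (a\<^sup>2 + \<tau> * sqrt (1 - (norm y)\<^sup>2))" for \<tau> and y :: "real ^ 'n"
  define \<Phi> where "\<Phi> \<tau> y = y + (\<rho> \<tau> y / sqrt N) *\<^sub>R (axis i2 \<alpha> - axis i1 \<beta>)" for \<tau> and y :: "real ^ 'n"
  have sumD: "(\<Sum>j\<in>UNIV - {i1, i2}. (y $ j)\<^sup>2) = (norm y)\<^sup>2" if "y $ i1 = 0" "y $ i2 = 0" for y :: "real ^ 'n"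
    using sum_UNIV_split2[OF assms(1), of "\<lambda>j. (y $ j)\<^sup>2"] that
    by (simp add: norm_vec_def L2_set_def sum_nonneg)
  have conv: "convex D"
  proof -
    have "convex {y :: real ^ 'n. y $ i = 0}" for i
      by (auto simp: convex_def)
    then show ?thesis unfolding D_def by (intro convex_Int convex_cball)
  qed
  have cont: "continuous_on D (\<Phi> \<tau>)" for \<tau>
    unfolding \<Phi>_def \<rho>_def by (intro continuous_intros)  (use N in auto)
  have conn: "connected (\<Phi> \<tau> ` D)" for \<tau>
    by (intro connected_continuous_image cont convex_connected conv)
  have \<rho>sq: "(\<rho> \<tau> y)\<^sup>2 = a\<^sup>2 + \<tau> * sqrt (1 - (norm y)\<^sup>2)" "\<rho> \<tau> y > 0"
    if "y \<in> D" "\<tau> \<in> {1, -1}" for \<tau> y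
  proof -
    have "norm y \<le> 1" using that by (simp add: D_def)
    have "sqrt (1 - (norm y)\<^sup>2) \<le> 1" by simp
    moreover have "a\<^sup>2 > 1" using assms(2) by (simp add: one_less_power)
    moreover have "sqrt (1 - (norm y)\<^sup>2) \<ge> 0"
      using \<open>norm y \<le> 1\<close> by (simp add: power_le_one)
    moreover have "\<tau> = 1 \<or> \<tau> = - 1" using that(2) by simp
    ultimately have "a\<^sup>2 + \<tau> * sqrt (1 - (norm y)\<^sup>2) > 0"
      by (elim disjE) (hypsubst, linarith)+
    then show "(\<rho> \<tau> y)\<^sup>2 = a\<^sup>2 + \<tau> * sqrt (1 - (norm y)\<^sup>2)" "\<rho> \<tau> y > 0"
      by (simp_all add: \<rho>_def)
  qed
  have eq: "half_meridian i1 i2 a \<alpha> \<beta> = \<Phi> 1 ` D \<union> \<Phi> (-1) ` D"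
  proof (intro equalityI subsetI)
    fix x assume "x \<in> half_meridian i1 i2 a \<alpha> \<beta>"
    then have S: "((x $ i1)\<^sup>2 + (x $ i2)\<^sup>2 - a\<^sup>2)\<^sup>2 + (\<Sum>j\<in>UNIV - {i1, i2}. (x $ j)\<^sup>2) = 1"
      and plane: "\<alpha> * x $ i1 + \<beta> * x $ i2 = 0" and pos: "\<alpha> * x $ i2 - \<beta> * x $ i1 > 0"
      by (auto simp: half_meridian_def mem_S_surface)
    define f where "f = \<alpha> * x $ i2 - \<beta> * x $ i1"
    have x1: "N * x $ i1 = - \<beta> * f" and x2: "N * x $ i2 = \<alpha> * f"
    proof -
      have "N * x $ i1 = \<alpha> * (\<alpha> * x $ i1 + \<beta> * x $ i2) - \<beta> * f"
        by (simp add: N_def f_def algebra_simps power2_eq_square)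
      then show "N * x $ i1 = - \<beta> * f" using plane by simp
      have "N * x $ i2 = \<beta> * (\<alpha> * x $ i1 + \<beta> * x $ i2) + \<alpha> * f"
        by (simp add: N_def f_def algebra_simps power2_eq_square)
      then show "N * x $ i2 = \<alpha> * f" using plane by simp
    qed
    define r2 where "r2 = (x $ i1)\<^sup>2 + (x $ i2)\<^sup>2"
    have "f\<^sup>2 + (\<alpha> * x $ i1 + \<beta> * x $ i2)\<^sup>2 = N * r2"
      by (simp add: N_def r2_def f_def algebra_simps power2_eq_square)
    then have f: "f = sqrt N * sqrt r2"
      using pos plane by (metis add_0_right f_def less_imp_le power_zero_numeral real_sqrt_mult real_sqrt_unique)
    define y :: "real ^ 'n" where "y = (\<chi> j. if j \<in> {i1, i2} then 0 else x $ j)"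
    have y12: "y $ i1 = 0" "y $ i2 = 0" by (auto simp: y_def)
    have "(\<Sum>j\<in>UNIV - {i1, i2}. (x $ j)\<^sup>2) = (\<Sum>j\<in>UNIV - {i1, i2}. (y $ j)\<^sup>2)"
      by (intro sum.cong) (auto simp: y_def)
    then have ny: "(r2 - a\<^sup>2)\<^sup>2 = 1 - (norm y)\<^sup>2"
      using S sumD[OF y12] by (simp add: r2_def)
    then have "(norm y)\<^sup>2 \<le> 1" by (metis diff_ge_0_iff_ge zero_le_power2)
    then have "norm y \<le> 1" by (simp add: abs_square_le_1)
    then have "y \<in> D" using y12 by (simp add: D_def)
    define \<tau> :: real where "\<tau> = (if r2 \<ge> a\<^sup>2 then 1 else -1)"
    have "r2 = a\<^sup>2 + \<tau> * sqrt (1 - (norm y)\<^sup>2)"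
      unfolding ny[symmetric] by (simp add: \<tau>_def)
    then have "\<rho> \<tau> y = sqrt r2" by (simp add: \<rho>_def)
    then have fN: "\<rho> \<tau> y / sqrt N = f / N"
      using N by (simp add: f field_simps)
    have "x $ i1 = - (f / N * \<beta>)" "x $ i2 = f / N * \<alpha>"
      using x1 x2 N by (simp_all add: field_simps)
    then have "x = y + (f / N) *\<^sub>R (axis i2 \<alpha> - axis i1 \<beta>)"
      using assms(1) by (auto simp: vec_eq_iff y_def axis_def)
    then have "x = \<Phi> \<tau> y" by (simp only: \<Phi>_def fN)
    then show "x \<in> \<Phi> 1 ` D \<union> \<Phi> (-1) ` D"
      using \<open>y \<in> D\<close> by (auto simp: \<tau>_def split: if_splits)
  next
    fix x assume "x \<in> \<Phi> 1 ` D \<union> \<Phi> (-1) ` D"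
    then obtain \<tau> y where \<tau>: "\<tau> \<in> {1, -1}" and y: "y \<in> D" and x: "x = \<Phi> \<tau> y" by blast
    define t where "t = \<rho> \<tau> y / sqrt N"
    have t: "t > 0" using \<rho>sq[OF y \<tau>] N by (simp add: t_def)
    have x12: "x $ i1 = - t * \<beta>" "x $ i2 = t * \<alpha>"
      using y assms(1) by (simp_all add: x \<Phi>_def t_def D_def axis_def)
    have "(\<Sum>j\<in>UNIV - {i1, i2}. (x $ j)\<^sup>2) = (\<Sum>j\<in>UNIV - {i1, i2}. (y $ j)\<^sup>2)"
      by (intro sum.cong) (auto simp: x \<Phi>_def axis_def)
    also have "\<dots> = (norm y)\<^sup>2" using y by (intro sumD) (auto simp: D_def)
    finally have ny: "(\<Sum>j\<in>UNIV - {i1, i2}. (x $ j)\<^sup>2) = (norm y)\<^sup>2" .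
    have "(x $ i1)\<^sup>2 + (x $ i2)\<^sup>2 = t\<^sup>2 * N"
      by (simp add: x12 N_def power2_eq_square algebra_simps)
    also have "\<dots> = (\<rho> \<tau> y)\<^sup>2" using N by (simp add: t_def power_divide)
    finally have "((x $ i1)\<^sup>2 + (x $ i2)\<^sup>2 - a\<^sup>2)\<^sup>2 = \<tau>\<^sup>2 * (sqrt (1 - (norm y)\<^sup>2))\<^sup>2"
      by (simp add: \<rho>sq[OF y \<tau>] power_mult_distrib)
    also have "\<dots> = 1 - (norm y)\<^sup>2"
      using y \<tau> by (auto simp: D_def power_le_one)
    finally have "x \<in> S_surface i1 i2 a" using ny by (simp add: mem_S_surface)
    moreover have "\<alpha> * x $ i1 + \<beta> * x $ i2 = 0" by (simp add: x12)
    moreover have "\<alpha> * x $ i2 - \<beta> * x $ i1 = t * N"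
      by (simp add: x12 N_def power2_eq_square algebra_simps)
    moreover have "t * N > 0" using t N by simp
    ultimately show "x \<in> half_meridian i1 i2 a \<alpha> \<beta>"
      by (simp only: half_meridian_def mem_Collect_eq)
  qed
  obtain j where j: "j \<notin> {i1, i2}" using third by blast
  have "axis j 1 \<in> D" using j by (auto simp: D_def axis_def norm_axis_1[unfolded axis_def])
  moreover have "\<Phi> 1 (axis j 1) = \<Phi> (-1) (axis j 1)" by (simp add: \<Phi>_def \<rho>_def)
  ultimately have "\<Phi> 1 ` D \<inter> \<Phi> (-1) ` D \<noteq> {}"
    by (metis IntI empty_iff imageI)
  then show "connected (half_meridian i1 i2 a \<alpha> \<beta>)"
    unfolding eq by (intro connected_Un conn)
  show "half_meridian i1 i2 a \<alpha> \<beta> \<noteq> {}"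
    unfolding eq using \<open>axis j 1 \<in> D\<close> by blast
qed

lemma components_two_signs:
  fixes f :: "'a::topological_space \<Rightarrow> real"
  assumes "continuous_on X f" "\<And>x. x \<in> X \<Longrightarrow> f x \<noteq> 0"
    and P: "P = {x \<in> X. f x > 0}" "connected P" "P \<noteq> {}"
    and Q: "Q = {x \<in> X. f x < 0}" "connected Q" "Q \<noteq> {}"
  shows "components X = {P, Q}"
proof -
  have sign: "C \<subseteq> P \<or> C \<subseteq> Q" if C: "connected C" "C \<subseteq> X" for C
  proof (rule ccontr)
    assume "\<not> ?thesis"
    then obtain x y where xy: "x \<in> C" "f x < 0" "y \<in> C" "f y > 0"
      using C(2) assms(2) P(1) Q(1)
      by (metis (mono_tags, lifting) linorder_neqE_linordered_idom mem_Collect_eq subsetD subsetI)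
    have "connected (f ` C)"
      using C assms(1) by (intro connected_continuous_image) (auto intro: continuous_on_subset)
    then have "{f x..f y} \<subseteq> f ` C" using xy by (intro connected_contains_Icc) auto
    then have "0 \<in> f ` C" using xy by auto
    then show False using C(2) assms(2) by auto
  qed
  have sub: "P \<inter> Q = {}" "P \<subseteq> X" "Q \<subseteq> X" using P(1) Q(1) by auto
  have P_comp: "P \<in> components X"
    unfolding in_components_maximal
  proof (intro conjI allI impI)
    fix C assume "C \<noteq> {} \<and> P \<subseteq> C \<and> C \<subseteq> X \<and> connected C"
    then show "C = P" using sign[of C] sub P(3) by blast
  qed (fact P sub)+
  have Q_comp: "Q \<in> components X"
    unfolding in_components_maximal
  proof (intro conjI allI impI)
    fix C assume "C \<noteq> {} \<and> Q \<subseteq> C \<and> C \<subseteq> X \<and> connected C"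
    then show "C = Q" using sign[of C] sub Q(3) by blast
  qed (fact Q sub)+
  have "C = P \<or> C = Q" if C: "C \<in> components X" for C
  proof -
    have "C \<noteq> {}" "C \<subseteq> P \<or> C \<subseteq> Q"
      using in_components_nonempty[OF C] sign[OF in_components_connected[OF C] in_components_subset[OF C]]
      by blast+
    then have "C \<inter> P \<noteq> {} \<or> C \<inter> Q \<noteq> {}" by blast
    then show ?thesis using components_eq[OF C P_comp] components_eq[OF C Q_comp] by blast
  qed
  then show ?thesis using P_comp Q_comp by blast
qed

lemma card_components_meridian:
  fixes i1 i2 :: "'n::finite"
  assumes "i1 \<noteq> i2" "a > 1" "\<exists>j. j \<notin> {i1, i2}" "g \<in> meridian_forms i1 i2"
  shows "card (components (zero_set g \<inter> S_surface i1 i2 a)) = 2"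
proof -
  obtain \<alpha> \<beta> where g: "g = pencil_form i1 i2 \<alpha> \<beta>" and nz: "(\<alpha>, \<beta>) \<noteq> (0, 0)"
    using assms(4) by (auto simp: meridian_forms_iff)
  let ?P = "half_meridian i1 i2 a \<alpha> \<beta>" and ?Q = "half_meridian i1 i2 a (- \<alpha>) (- \<beta>)"
  have Q_nz: "(- \<alpha>, - \<beta>) \<noteq> (0, 0)" using nz by simp
  have "components (zero_set g \<inter> S_surface i1 i2 a) = {?P, ?Q}"
  proof (rule components_two_signs[where f = "\<lambda>x. \<alpha> * x $ i2 - \<beta> * x $ i1"])
    fix x assume x: "x \<in> zero_set g \<inter> S_surface i1 i2 a"
    show "\<alpha> * x $ i2 - \<beta> * x $ i1 \<noteq> 0"
    proof
      assume f: "\<alpha> * x $ i2 - \<beta> * x $ i1 = 0"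
      have p: "\<alpha> * x $ i1 + \<beta> * x $ i2 = 0"
        using x by (simp add: g zero_set_def eval_pencil_form)
      have "(\<alpha>\<^sup>2 + \<beta>\<^sup>2) * ((x $ i1)\<^sup>2 + (x $ i2)\<^sup>2)
          = (\<alpha> * x $ i2 - \<beta> * x $ i1)\<^sup>2 + (\<alpha> * x $ i1 + \<beta> * x $ i2)\<^sup>2"
        by (simp add: algebra_simps power2_eq_square)
      then have "(\<alpha>\<^sup>2 + \<beta>\<^sup>2) * ((x $ i1)\<^sup>2 + (x $ i2)\<^sup>2) = 0" using f p by simp
      then show False
        using nz axis_free[of x i1 i2 a] x assms(2) by (auto simp: sum_power2_eq_zero_iff)
    qed
  qed (use half_meridian_connected_nonempty[OF assms(1,2) nz assms(3)]
           half_meridian_connected_nonempty[OF assms(1,2) Q_nz assms(3)] in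
       \<open>auto simp: half_meridian_def g zero_set_def eval_pencil_form intro!: continuous_intros\<close>)
  moreover have "?P \<noteq> ?Q"
  proof -
    obtain x where "x \<in> ?P" using half_meridian_connected_nonempty[OF assms(1,2) nz assms(3)] by blast
    moreover from this have "x \<notin> ?Q" by (simp add: half_meridian_def)
    ultimately show ?thesis by blast
  qed
  ultimately show ?thesis by simp
qed

section \<open>Counting meridians with multiplicity\<close>

lemma pencil_form_dvd_extactic:
  fixes i1 i2 :: "'n::finite"
  assumes "i1 \<noteq> i2" "g \<in> meridian_forms i1 i2" "vf_invariant R g"
  shows "g dvd extactic i1 i2 R"
proof -
  obtain \<alpha> \<beta> where g: "g = pencil_form i1 i2 \<alpha> \<beta>" and nz: "(\<alpha>, \<beta>) \<noteq> (0, 0)"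
    using assms(2) by (auto simp: meridian_forms_iff)
  obtain K where "vf_apply R g = K * g"
    using assms(3) by (auto simp: vf_invariant_def)
  then have K: "Const \<alpha> * R i1 + Const \<beta> * R i2 = K * g"
    by (simp add: g vf_apply_pencil_form[OF assms(1)])
  have "Const \<alpha> * extactic i1 i2 R = g * R i2 - Var i2 * (Const \<alpha> * R i1 + Const \<beta> * R i2)"
    by (simp add: extactic_def g pencil_form_def algebra_simps)
  then have 1: "g dvd Const \<alpha> * extactic i1 i2 R" unfolding K by simp
  have "Const \<beta> * extactic i1 i2 R = Var i1 * (Const \<alpha> * R i1 + Const \<beta> * R i2) - g * R i1"
    by (simp add: extactic_def g pencil_form_def algebra_simps)
  then have 2: "g dvd Const \<beta> * extactic i1 i2 R" unfolding K by simp
  have cancel: "g dvd p" if "g dvd Const c * p" "c \<noteq> 0" for c p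
  proof -
    have "g dvd Const (1 / c) * (Const c * p)" using that(1) by (rule dvd_mult)
    moreover have "Const (1 / c) * (Const c * p) = p"
      using that(2) by (simp add: Const_def mult_single flip: mult.assoc)
    ultimately show ?thesis by simp
  qed
  show ?thesis using cancel[OF 1] cancel[OF 2] nz by blast
qed

lemma proportional_forms_power_dvd:
  assumes "\<alpha> * \<beta>' - \<alpha>' * \<beta> = 0" "(\<alpha>, \<beta>) \<noteq> (0, 0)" "(\<alpha>', \<beta>') \<noteq> (0, 0)"
    and "pencil_form i1 i2 \<alpha> \<beta> ^ k dvd p"
  shows "pencil_form i1 i2 \<alpha>' \<beta>' ^ k dvd p"
proof -
  obtain c where "\<alpha> = c * \<alpha>'" "\<beta> = c * \<beta>'"
  proof (cases "\<alpha>' = 0")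
    case True
    then show ?thesis using assms(1-3) that[of "\<beta> / \<beta>'"] by auto
  next
    case False
    then show ?thesis using assms(1-3) that[of "\<alpha> / \<alpha>'"] by (auto simp: field_simps)
  qed
  then have "pencil_form i1 i2 \<alpha>' \<beta>' dvd pencil_form i1 i2 \<alpha> \<beta>"
    by (simp add: pencil_form_scale)
  then show ?thesis using assms(4) dvd_power_same dvd_trans by blast
qed

lemma proportional_forms_zero_set:
  assumes "\<alpha> * \<beta>' - \<alpha>' * \<beta> = 0" "(\<alpha>, \<beta>) \<noteq> (0, 0)" "(\<alpha>', \<beta>') \<noteq> (0, 0)"
  shows "zero_set (pencil_form i1 i2 \<alpha> \<beta>) = zero_set (pencil_form i1 i2 \<alpha>' \<beta>')"
proof -
  have *: "\<alpha>' * u + \<beta>' * v = 0"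
    if "\<alpha> * u + \<beta> * v = 0" "\<alpha> * \<beta>' - \<alpha>' * \<beta> = 0" "(\<alpha>, \<beta>) \<noteq> (0, 0)" for \<alpha> \<beta> \<alpha>' \<beta>' u v :: real
  proof -
    have "\<alpha> * (\<alpha>' * u + \<beta>' * v) = \<alpha>' * (\<alpha> * u + \<beta> * v) + (\<alpha> * \<beta>' - \<alpha>' * \<beta>) * v"
      "\<beta> * (\<alpha>' * u + \<beta>' * v) = \<beta>' * (\<alpha> * u + \<beta> * v) - (\<alpha> * \<beta>' - \<alpha>' * \<beta>) * u"
      by (simp_all add: algebra_simps)
    then show ?thesis using that by auto
  qed
  have "\<alpha>' * u + \<beta>' * v = 0" if "\<alpha> * u + \<beta> * v = 0" for u v
    using *[OF that assms(1,2)] .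
  moreover have "\<alpha> * u + \<beta> * v = 0" if "\<alpha>' * u + \<beta>' * v = 0" for u v
    using *[OF that, of \<beta> \<alpha>] assms(1,3) by (simp add: mult.commute)
  ultimately show ?thesis unfolding zero_set_def eval_pencil_form by blast
qed

lemma forms_meeting_proportional:
  assumes "\<alpha> * u + \<beta> * v = 0" "\<alpha>' * u + \<beta>' * v = 0" "u \<noteq> 0 \<or> v \<noteq> (0::real)"
  shows "\<alpha> * \<beta>' - \<alpha>' * \<beta> = 0"
proof -
  have "(\<alpha> * \<beta>' - \<alpha>' * \<beta>) * u = \<beta>' * (\<alpha> * u + \<beta> * v) - \<beta> * (\<alpha>' * u + \<beta>' * v)"
    "(\<alpha> * \<beta>' - \<alpha>' * \<beta>) * v = \<alpha> * (\<alpha>' * u + \<beta>' * v) - \<alpha>' * (\<alpha> * u + \<beta> * v)"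
    by (simp_all add: algebra_simps)
  then show ?thesis using assms by auto
qed

text \<open>The forms that determine the multiplicities of two meridians are equal or independent, so that
  the bound on hyperplanes applies to the set \<open>G\<close> of all these forms, and each of them accounts for two
  meridians. The last claim turns a divisor of the extactic polynomial into a lower bound for
  the count.\<close>

lemma sum_hyperplane_mults:
  fixes i1 i2 :: "'n::finite"
  assumes "i1 \<noteq> i2" "a > 1" "\<exists>j. j \<notin> {i1, i2}"
    and field: "vf_degree R \<le> m" "vf_on_S i1 i2 a R" "extactic i1 i2 R \<noteq> 0"
  defines "Inv \<equiv> invariant_meridians i1 i2 a R"
  shows "finite Inv"
    and "(\<Sum>M\<in>Inv. meridian_mult i1 i2 a R M) \<le> 2 * (m - 1)"
    and "\<And>g k. g \<in> meridian_forms i1 i2 \<Longrightarrow> vf_invariant R g \<Longrightarrow> g ^ k dvd extactic i1 i2 R \<Longrightarrow>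
           2 * k \<le> (\<Sum>M\<in>Inv. meridian_mult i1 i2 a R M)"
proof -
  define cuts where "cuts M g \<longleftrightarrow> g \<in> meridian_forms i1 i2 \<and>
      M \<in> components (zero_set g \<inter> S_surface i1 i2 a)" for M and g :: "'n mpoly"
  define F where "F M = (SOME g. cuts M g)" for M
  have mult_F: "meridian_mult i1 i2 a R M = hyperplane_mult i1 i2 R (F M)" for M
    by (simp add: meridian_mult_def F_def cuts_def)
  define A B where "A g = (SOME \<alpha>. \<exists>\<beta>. g = pencil_form i1 i2 \<alpha> \<beta> \<and> (\<alpha>, \<beta>) \<noteq> (0, 0))"
    and "B g = (SOME \<beta>. g = pencil_form i1 i2 (A g) \<beta> \<and> (A g, \<beta>) \<noteq> (0, 0))" for g
  have AB: "pencil_form i1 i2 (A g) (B g) = g" "(A g, B g) \<noteq> (0, 0)" if "g \<in> meridian_forms i1 i2" for g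
  proof -
    have "\<exists>\<beta>. g = pencil_form i1 i2 (A g) \<beta> \<and> (A g, \<beta>) \<noteq> (0, 0)"
      unfolding A_def by (rule someI_ex) (use that in \<open>simp only: meridian_forms_iff\<close>)
    then have "g = pencil_form i1 i2 (A g) (B g) \<and> (A g, B g) \<noteq> (0, 0)"
      unfolding B_def by (rule someI_ex)
    then show "pencil_form i1 i2 (A g) (B g) = g" "(A g, B g) \<noteq> (0, 0)" by auto
  qed
  have prop_zero: "zero_set g = zero_set g'"
    if "A g * B g' - A g' * B g = 0" "g \<in> meridian_forms i1 i2" "g' \<in> meridian_forms i1 i2" for g g'
    using proportional_forms_zero_set[OF that(1)] AB that(2,3) by metis
  have cuts_prop: "A g * B g' - A g' * B g = 0" if c: "cuts M g" "cuts M g'" for M g g'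
  proof -
    obtain x where "x \<in> M" using c(1) in_components_nonempty by (fastforce simp: cuts_def)
    then have x: "x \<in> S_surface i1 i2 a" "x \<in> zero_set g" "x \<in> zero_set g'"
      using c by (auto simp: cuts_def dest!: in_components_subset)
    then have "mpoly_eval (pencil_form i1 i2 (A g) (B g)) x = 0"
      "mpoly_eval (pencil_form i1 i2 (A g') (B g')) x = 0"
      using c AB by (simp_all add: zero_set_def cuts_def)
    then show ?thesis
      unfolding eval_pencil_form using axis_free[OF x(1) assms(2)]
      by (rule forms_meeting_proportional)
  qed
  have cuts_F: "cuts M (F M)" if "cuts M g" for M g
    unfolding F_def using that by (rule someI)
  have F_dvd: "F M ^ k dvd extactic i1 i2 R" if "cuts M g" "g ^ k dvd extactic i1 i2 R" for M g k
    using proportional_forms_power_dvd[of "A g" "B (F M)" "A (F M)" "B g" i1 i2 k "extactic i1 i2 R"]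
      cuts_prop[OF that(1) cuts_F[OF that(1)]] AB[of g] AB[of "F M"] that cuts_F[OF that(1)]
    by (simp add: cuts_def)
  have Inv: "\<exists>g. cuts M g \<and> vf_invariant R g" if "M \<in> Inv" for M
    using that by (auto simp: Inv_def invariant_meridians_def cuts_def)
  have cuts_F_Inv: "cuts M (F M)" if "M \<in> Inv" for M
    using Inv[OF that] cuts_F by blast
  \<comment> \<open>Proportional forms cut out the same set, so they describe the same choice.\<close>
  have F_eq: "F M = F M'" if "M \<in> Inv" "M' \<in> Inv" "A (F M) * B (F M') - A (F M') * B (F M) = 0" for M M'
  proof -
    have c: "cuts M (F M)" "cuts M' (F M')" using that cuts_F_Inv by auto
    then have z: "zero_set (F M) = zero_set (F M')"
      using that(3) by (intro prop_zero) (auto simp: cuts_def)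
    have "cuts M g \<longleftrightarrow> cuts M' g" for g
    proof -
      have "zero_set g = zero_set (F M)" if "cuts M g"
        using cuts_prop[OF that c(1)] that c by (intro prop_zero) (auto simp: cuts_def)
      moreover have "zero_set g = zero_set (F M')" if "cuts M' g"
        using cuts_prop[OF that c(2)] that c by (intro prop_zero) (auto simp: cuts_def)
      ultimately show ?thesis using c z by (auto simp: cuts_def)
    qed
    then show ?thesis by (simp add: F_def)
  qed
  define G where "G = F ` Inv"
  have G_form: "g \<in> meridian_forms i1 i2" if "g \<in> G" for g
    using that cuts_F_Inv by (auto simp: G_def cuts_def)
  have G_dvd: "g dvd extactic i1 i2 R" if g: "g \<in> G" for g
  proof -
    obtain M where M: "M \<in> Inv" "g = F M" using g by (auto simp: G_def)
    obtain g0 where g0: "cuts M g0" "vf_invariant R g0" using Inv[OF M(1)] by blast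
    then have "g0 ^ 1 dvd extactic i1 i2 R"
      using pencil_form_dvd_extactic[OF assms(1)] by (simp add: cuts_def)
    then show ?thesis using F_dvd[OF g0(1)] M by (metis power_one_right)
  qed
  have bound: "sum \<mu> I \<le> m - 1"
    if fin: "finite I" and sub: "I \<subseteq> G" and dvd: "\<And>g. g \<in> I \<Longrightarrow> g ^ \<mu> g dvd extactic i1 i2 R"
    for I \<mu>
  proof (rule sum_pencil_multiplicities_le[OF assms(1) field fin, of A B])
    fix g assume "g \<in> I"
    then have "g \<in> G" using sub by blast
    show "(A g, B g) \<noteq> (0, 0)" and "pencil_form i1 i2 (A g) (B g) ^ \<mu> g dvd extactic i1 i2 R"
      using AB[OF G_form[OF \<open>g \<in> G\<close>]] dvd[OF \<open>g \<in> I\<close>] by simp_all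
    fix g' assume "g' \<in> I" "g \<noteq> g'"
    obtain M M' where M: "M \<in> Inv" "g = F M" "M' \<in> Inv" "g' = F M'"
      using \<open>g \<in> G\<close> \<open>g' \<in> I\<close> sub unfolding G_def by blast
    show "A g * B g' - A g' * B g \<noteq> 0"
      using F_eq[OF M(1,3)] \<open>g \<noteq> g'\<close> unfolding M by blast
  qed
  have "finite G"
  proof (rule ccontr)
    assume "infinite G"
    then obtain I where I: "finite I" "card I = m" "I \<subseteq> G"
      using infinite_arbitrarily_large by blast
    have "m \<le> m - 1"
      using bound[OF I(1,3), of "\<lambda>_. 1"] I G_dvd by auto
    then have "m = 0" by linarith
    obtain g where "g \<in> G" using \<open>infinite G\<close> by fastforce
    then show False using bound[of "{g}" "\<lambda>_. 1"] G_dvd \<open>m = 0\<close> by auto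
  qed
  have comp2: "card (components (zero_set g \<inter> S_surface i1 i2 a)) = 2" if "g \<in> meridian_forms i1 i2" for g
    using card_components_meridian[OF assms(1-3) that] .
  have "Inv \<subseteq> (\<Union>g\<in>G. components (zero_set g \<inter> S_surface i1 i2 a))"
    using cuts_F_Inv by (auto simp: G_def cuts_def)
  moreover have fin_comp: "finite (components (zero_set g \<inter> S_surface i1 i2 a))" if "g \<in> meridian_forms i1 i2" for g
    using comp2[OF that] by (intro card_ge_0_finite) simp
  ultimately show fin: "finite Inv"
    using \<open>finite G\<close> G_form by (meson finite_UN_I finite_subset)
  let ?h = "hyperplane_mult i1 i2 R"
  have power_bound: "k \<le> m - 1" if "g \<in> G" "g ^ k dvd extactic i1 i2 R" for g k
    using bound[of "{g}" "\<lambda>_. k"] that by auto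
  have h_dvd: "g ^ ?h g dvd extactic i1 i2 R" if "g \<in> G" for g
    unfolding hyperplane_mult_def
    by (rule GreatestI_nat[of _ 0]) (use power_bound[OF that] in auto)
  have h_ge: "k \<le> ?h g" if "g \<in> G" "g ^ k dvd extactic i1 i2 R" for g k
    unfolding hyperplane_mult_def
    by (rule Greatest_le_nat) (use power_bound[OF that(1)] that in auto)
  have "(\<Sum>M\<in>Inv. meridian_mult i1 i2 a R M) = (\<Sum>g\<in>G. \<Sum>M\<in>{M \<in> Inv. F M = g}. ?h (F M))"
    unfolding mult_F G_def using sum.image_gen[OF fin] .
  also have "\<dots> = (\<Sum>g\<in>G. card {M \<in> Inv. F M = g} * ?h g)"
    by (intro sum.cong) auto
  also have "\<dots> \<le> (\<Sum>g\<in>G. 2 * ?h g)"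
  proof (intro sum_mono mult_right_mono)
    fix g assume "g \<in> G"
    have "{M \<in> Inv. F M = g} \<subseteq> components (zero_set g \<inter> S_surface i1 i2 a)"
      using cuts_F_Inv by (auto simp: cuts_def)
    then show "card {M \<in> Inv. F M = g} \<le> 2"
      using comp2[OF G_form[OF \<open>g \<in> G\<close>]] fin_comp[OF G_form[OF \<open>g \<in> G\<close>]] card_mono by metis
  qed simp
  also have "\<dots> \<le> 2 * (m - 1)"
    using bound[OF \<open>finite G\<close> subset_refl, of ?h] h_dvd by (simp flip: sum_distrib_left)
  finally show "(\<Sum>M\<in>Inv. meridian_mult i1 i2 a R M) \<le> 2 * (m - 1)" .
  fix g k assume g: "g \<in> meridian_forms i1 i2" "vf_invariant R g" "g ^ k dvd extactic i1 i2 R"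
  let ?C = "components (zero_set g \<inter> S_surface i1 i2 a)"
  have sub: "?C \<subseteq> Inv" using g by (auto simp: Inv_def invariant_meridians_def)
  have "2 * k = (\<Sum>M\<in>?C. k)" using comp2[OF g(1)] by simp
  also have "\<dots> \<le> (\<Sum>M\<in>?C. meridian_mult i1 i2 a R M)"
  proof (rule sum_mono)
    fix M assume "M \<in> ?C"
    then have "cuts M g" "M \<in> Inv" using g sub by (auto simp: cuts_def)
    then show "k \<le> meridian_mult i1 i2 a R M"
      unfolding mult_F using F_dvd g(3) by (intro h_ge) (auto simp: G_def)
  qed
  also have "\<dots> \<le> (\<Sum>M\<in>Inv. meridian_mult i1 i2 a R M)"
    using fin sub by (intro sum_mono2) auto
  finally show "2 * k \<le> (\<Sum>M\<in>Inv. meridian_mult i1 i2 a R M)" .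
qed

section \<open>A vanishing extactic polynomial\<close>

lemma lookup_Var_mult_add:
  "Poly_Mapping.lookup (Var i * p) (e + Poly_Mapping.single i 1) = Poly_Mapping.lookup p e"
proof (induction p rule: mpoly_induct)
  case (single f c)
  show ?case by (auto simp: Var_def mult_single lookup_single when_def add.commute)
qed (simp add: ring_distribs lookup_add)

lemma lookup_Var_mult_0:
  assumes "Poly_Mapping.lookup e i = 0"
  shows "Poly_Mapping.lookup (Var i * p) e = 0"
proof (induction p rule: mpoly_induct)
  case (single f c)
  have "Poly_Mapping.single i 1 + f \<noteq> e"
    using assms by (auto simp: lookup_add dest!: arg_cong[of _ _ "\<lambda>f. Poly_Mapping.lookup f i"])
  then show ?case by (simp add: Var_def mult_single lookup_single when_def)
qed (simp add: ring_distribs lookup_add)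

lemma Var_mult_cancel:
  assumes "Var i * p = Var i * q"
  shows "p = q"
proof (rule poly_mapping_eqI)
  fix e
  have "Poly_Mapping.lookup (Var i * p) (e + Poly_Mapping.single i 1)
      = Poly_Mapping.lookup (Var i * q) (e + Poly_Mapping.single i 1)"
    by (simp only: assms)
  then show "Poly_Mapping.lookup p e = Poly_Mapping.lookup q e"
    by (simp only: lookup_Var_mult_add)
qed

lemma Var_dvdI:
  assumes "\<And>e. Poly_Mapping.lookup e i = 0 \<Longrightarrow> Poly_Mapping.lookup p e = 0"
  shows "Var i dvd p"
proof -
  have "p = (\<Sum>e\<in>Poly_Mapping.keys p. Poly_Mapping.single e (Poly_Mapping.lookup p e))"
    by (rule poly_mapping_eqI) (auto simp: lookup_sum lookup_single when_def in_keys_iff)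
  also have "Var i dvd \<dots>"
  proof (rule dvd_sum)
    fix e assume "e \<in> Poly_Mapping.keys p"
    then have "Poly_Mapping.lookup e i \<noteq> 0" using assms by (auto simp: in_keys_iff)
    then have "Poly_Mapping.single i 1 + (e - Poly_Mapping.single i 1) = e"
      by (intro poly_mapping_eqI) (auto simp: lookup_add lookup_minus lookup_single when_def)
    then have "Poly_Mapping.single e (Poly_Mapping.lookup p e)
        = Var i * Poly_Mapping.single (e - Poly_Mapping.single i 1) (Poly_Mapping.lookup p e)"
      by (simp add: Var_def mult_single)
    then show "Var i dvd Poly_Mapping.single e (Poly_Mapping.lookup p e)" by (metis dvd_triv_left)
  qed
  finally show ?thesis .
qed

lemma radial_if_extactic_0:
  fixes i1 i2 :: "'n::finite"
  assumes "i1 \<noteq> i2" "extactic i1 i2 R = 0"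
  obtains P where "R i1 = Var i1 * P" "R i2 = Var i2 * P"
proof -
  have eq: "Var i1 * R i2 = Var i2 * R i1" using assms(2) by (simp add: extactic_def)
  have "Var i1 dvd R i1"
  proof (rule Var_dvdI)
    fix e :: "'n \<Rightarrow>\<^sub>0 nat"
    assume e: "Poly_Mapping.lookup e i1 = 0"
    have "Poly_Mapping.lookup (R i1) e = Poly_Mapping.lookup (Var i1 * R i2) (e + Poly_Mapping.single i2 1)"
      unfolding eq lookup_Var_mult_add ..
    also have "\<dots> = 0"
      using assms(1) e by (intro lookup_Var_mult_0) (simp add: lookup_add lookup_single when_def)
    finally show "Poly_Mapping.lookup (R i1) e = 0" .
  qed
  then obtain P where P: "R i1 = Var i1 * P" by blast
  have "Var i1 * R i2 = Var i1 * (Var i2 * P)"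
    unfolding eq P by (rule mult.left_commute)
  from Var_mult_cancel[OF this] show ?thesis using that P by blast
qed

text \<open>A field that is radial in the first two coordinates preserves every hyperplane of the pencil.\<close>

lemma infinite_invariant_sets_if_extactic_0:
  fixes i1 i2 :: "'n::finite"
  assumes "i1 \<noteq> i2" "extactic i1 i2 R = 0"
  shows "infinite (invariant_algebraic_sets R)"
proof -
  obtain P where P: "R i1 = Var i1 * P" "R i2 = Var i2 * P"
    using radial_if_extactic_0[OF assms] .
  let ?Z = "\<lambda>l. zero_set (pencil_form i1 i2 1 l) :: (real ^ 'n) set"
  have "inj ?Z"
  proof (rule injI)
    fix l l' assume eq: "?Z l = ?Z l'"
    let ?x = "axis i2 1 - axis i1 l :: real ^ 'n"
    have "?x \<in> ?Z l" using assms(1) by (simp add: zero_set_def eval_pencil_form axis_def)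
    then have "?x \<in> ?Z l'" using eq by simp
    then show "l = l'" using assms(1) by (simp add: zero_set_def eval_pencil_form axis_def)
  qed
  then have "infinite (range ?Z)" using infinite_UNIV_char_0 by (simp add: finite_image_iff)
  moreover have "range ?Z \<subseteq> invariant_algebraic_sets R"
  proof
    fix Z assume "Z \<in> range ?Z"
    then obtain l where Z: "Z = ?Z l" by blast
    have "vf_apply R (pencil_form i1 i2 1 l) = P * pencil_form i1 i2 1 l"
      unfolding vf_apply_pencil_form[OF assms(1)] P by (simp add: pencil_form_def algebra_simps)
    then show "Z \<in> invariant_algebraic_sets R"
      unfolding Z invariant_algebraic_sets_def vf_invariant_def by blast
  qed
  ultimately show ?thesis using finite_subset by blast
qed

section \<open>A field attaining the bound\<close>

lemma total_degree_0: "total_degree 0 = 0"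
  by (simp add: total_degree_def)

lemma total_degree_single:
  "c \<noteq> 0 \<Longrightarrow> total_degree (Poly_Mapping.single e c) = (\<Sum>i\<in>UNIV. Poly_Mapping.lookup e i)"
  by (simp add: total_degree_def)

lemma Var_power: "Var i ^ k = Poly_Mapping.single (Poly_Mapping.single i k) 1"
  by (induction k) (simp_all add: Var_def mult_single flip: single_add)

text \<open>The rotation in the first two coordinates leaves \<open>h\<close> invariant. Multiplied by \<open>x\<^sub>1\<^sup>k\<close>, it makes
  \<open>x\<^sub>1 = 0\<close> an invariant hyperplane of multiplicity at least \<open>k\<close>, since the extactic polynomial is
  \<open>(x\<^sub>1\<^sup>2 + x\<^sub>2\<^sup>2) x\<^sub>1\<^sup>k\<close>.\<close>

definition rotation_field :: "'n \<Rightarrow> 'n \<Rightarrow> nat \<Rightarrow> 'n \<Rightarrow> 'n mpoly" where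
  "rotation_field i1 i2 k =
     (\<lambda>_. 0)(i1 := - (Var i2 * Var i1 ^ k), i2 := Var i1 * Var i1 ^ k)"

lemma rotation_field_properties:
  fixes i1 i2 :: "'n::finite"
  assumes "i1 \<noteq> i2" "k > 0"
  defines "R \<equiv> rotation_field i1 i2 k"
  shows "vf_degree R = k + 1" "vf_on_S i1 i2 a R" "extactic i1 i2 R \<noteq> 0"
    "vf_invariant R (Var i1)" "Var i1 ^ k dvd extactic i1 i2 R"
proof -
  have R: "R i1 = - (Var i2 * Var i1 ^ k)" "R i2 = Var i1 * Var i1 ^ k" "\<And>j. j \<notin> {i1, i2} \<Longrightarrow> R j = 0"
    using assms(1) by (auto simp: R_def rotation_field_def)
  have mono: "total_degree (Poly_Mapping.single (Poly_Mapping.single i 1 + Poly_Mapping.single j k) c) = k + 1"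
    if "c \<noteq> 0" for i j :: 'n and c
    using that by (simp add: total_degree_single lookup_add lookup_single sum.distrib when_def)
  have "R i1 = Poly_Mapping.single (Poly_Mapping.single i2 1 + Poly_Mapping.single i1 k) (- 1)"
    "R i2 = Poly_Mapping.single (Poly_Mapping.single i1 1 + Poly_Mapping.single i1 k) 1"
    unfolding R Var_power by (simp_all add: Var_def mult_single single_uminus)
  then have deg: "total_degree (R i1) = k + 1" "total_degree (R i2) = k + 1"
    using mono by simp_all
  show "vf_degree R = k + 1"
    unfolding vf_degree_def
  proof (rule Max_eqI)
    show "k + 1 \<in> range (\<lambda>i. total_degree (R i))" using deg(1) by (metis rangeI)
    fix d assume "d \<in> range (\<lambda>i. total_degree (R i))"
    then obtain j where "d = total_degree (R j)" by blast
    then show "d \<le> k + 1"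
      using deg R(3)[of j] by (cases "j \<in> {i1, i2}") (auto simp: total_degree_0)
  qed simp
  have "vf_apply R (h_poly i1 i2 a) = 0"
    unfolding vf_apply_h_poly[OF assms(1)] using R by (simp add: algebra_simps)
  then show "vf_on_S i1 i2 a R" unfolding vf_on_S_def by (metis mult_zero_left)
  have E: "extactic i1 i2 R = ((Var i1)\<^sup>2 + (Var i2)\<^sup>2) * Var i1 ^ k"
    by (simp add: extactic_def R algebra_simps power2_eq_square)
  have "mpoly_eval (extactic i1 i2 R) (axis i1 1) = 1"
    unfolding E mpoly_eval_simps using assms(1) by (simp add: axis_def)
  moreover have "mpoly_eval 0 (axis i1 1 :: real ^ 'n) = 0" by (simp add: mpoly_eval_def)
  ultimately show "extactic i1 i2 R \<noteq> 0" by force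
  show "Var i1 ^ k dvd extactic i1 i2 R" unfolding E by simp
  have "vf_apply R (pencil_form i1 i2 1 0) = R i1"
    unfolding vf_apply_pencil_form[OF assms(1)] by (simp add: Const_def)
  then have "vf_apply R (Var i1) = - (Var i2 * Var i1 ^ (k - 1)) * Var i1"
    using assms(2) by (cases k) (simp_all add: R pencil_form_def Const_def ac_simps)
  then show "vf_invariant R (Var i1)" unfolding vf_invariant_def by blast
qed

section \<open>The theorem\<close>

theorem theorem5p2:
  fixes i1 i2 :: "'n::finite" and q m :: nat and a :: real
  assumes "q \<ge> 2" and "CARD('n) = q + 2" and "i1 \<noteq> i2" and "a > 1" and "m > 0"
  shows "(\<forall>R :: 'n \<Rightarrow> 'n mpoly.
            vf_degree R = m \<longrightarrow> vf_on_S i1 i2 a R \<longrightarrow> finite (invariant_algebraic_sets R) \<longrightarrow>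
            (\<exists>N. has_meridian_count i1 i2 a R N \<and> N \<le> 2 * (m - 1))) \<and>
         (m - 1 \<ge> q \<longrightarrow>
            (\<exists>R :: 'n \<Rightarrow> 'n mpoly.
               vf_degree R = m \<and> vf_on_S i1 i2 a R \<and> has_meridian_count i1 i2 a R (2 * (m - 1))))"
proof (intro conjI allI impI)
  have third: "\<exists>j. j \<notin> {i1, i2}"
  proof (rule ccontr)
    assume "\<not> ?thesis"
    then have U: "(UNIV :: 'n set) = {i1, i2}" by auto
    have "CARD('n) = 2" unfolding U using assms(3) by simp
    then show False using assms(1,2) by simp
  qed
  note count = sum_hyperplane_mults[OF assms(3,4) third]
  {
    fix R :: "'n \<Rightarrow> 'n mpoly"
    assume R: "vf_degree R = m" "vf_on_S i1 i2 a R" "finite (invariant_algebraic_sets R)"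
    then have "extactic i1 i2 R \<noteq> 0"
      using infinite_invariant_sets_if_extactic_0[OF assms(3)] by blast
    then show "\<exists>N. has_meridian_count i1 i2 a R N \<and> N \<le> 2 * (m - 1)"
      using count(1,2)[of R m] R by (auto simp: has_meridian_count_def)
  next
    assume "m - 1 \<ge> q"
    then have "m - 1 > 0" using assms(1) by linarith
    define R where "R = rotation_field i1 i2 (m - 1)"
    note R = rotation_field_properties[OF assms(3) \<open>m - 1 > 0\<close>, folded R_def]
    have "Var i1 = pencil_form i1 i2 1 0" by (simp add: pencil_form_def Const_def)
    then have form: "Var i1 \<in> meridian_forms i1 i2" unfolding meridian_forms_iff by force
    have m: "vf_degree R = m" using R(1) assms(5) by simp
    have "(\<Sum>M\<in>invariant_meridians i1 i2 a R. meridian_mult i1 i2 a R M) = 2 * (m - 1)"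
      using count(2)[of R m] count(3)[of R m, OF _ _ _ form] R m by (intro antisym) auto
    then have "has_meridian_count i1 i2 a R (2 * (m - 1))"
      using count(1)[of R m] R m by (simp add: has_meridian_count_def)
    then show "\<exists>R :: 'n \<Rightarrow> 'n mpoly.
        vf_degree R = m \<and> vf_on_S i1 i2 a R \<and> has_meridian_count i1 i2 a R (2 * (m - 1))"
      using R(2) m by blast
  }
qed

end
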